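(* Let $n\ge2$. For every positive integer $N$ the number of partitions $$N=\sum_{m\ge1}m f_m\qquad(f_m\in\mathbb Z_{\ge0})$$ satisfying the congruence conditions $f_m=0$ if $m\equiv0,\pm2\pmod{2n+4}$ equals the number of colored partitions $$N=\sum_{m_b\in\mathcal D_n}|m_b|\,f_{m_b}\qquad(f_{m_b}\in\mathbb Z_{\ge0})$$ satisfying the difference conditions: $f_{m_b}\le1$ for every $m_b\in\mathcal D_n$, and $f_{m_b}+f_{m'_{b'}}\le1$ for all distinct $m_b,m'_{b'}\in\mathcal D_n$ such that - $m_b=m_{ab}(-j-1)$ and $m'_{b'}=m'_{a'b'}(-j)$ for some $j\geq 1$, with $b\le a'$; or - $m_b=m_{ab}(-j)$ and $m'_{b'}=m'_{a'b'}(-j)$ for some $j\geq 1$, with $b\le b'$ and $a\ge a'$.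
   Context: $\mathcal D_n$ is the set of positive integers in $2n$ colors defined as follows: a colored integer is a symbol $m_b$ with color $b\in\{1,\dots,2n\}$ and value $|m_b|=m$; $\mathcal D_n$ is the disjoint union over $b=1,\dots,2n$ of the sets $$\{m_b\mid m\ge b,\ m\equiv b,b+1,\dots,2b-1\ (\mathrm{mod}\ 2n)\}.$$ Each $m_b\in\mathcal D_n$ can be written uniquely in the form $m=a+b-1+2n(j-1)$ with integers $1\le a\le b$ and $j\ge1$; one then writes $m_{ab}(-j)$ for $m_b$. (Thus for each $j\ge 1$ the elements $m_{ab}(-j)$ form a triangle with rows $b=1,\dots,2n$ and columns $a=1,\dots,b$.) In a partition, $f_m$ is the multiplicity of the part $m$; in a colored partition, $f_{m_b}$ is the multiplicity of the colored part $m_b$. All inequalities between indices $a,b,a',b'$ are between natural numbers. *)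

theory Defs
  imports "HOL-Library.Multiset" "HOL-Number_Theory.Cong"
begin

text \<open>The colored integer \<open>m\<^sub>b\<close> is the pair \<open>(m, b)\<close> of its value and its color.
  A partition is the finite multiset of its parts, so the multiplicity \<open>f\<close> is \<open>count\<close>.\<close>

type_synonym colored_int = "nat \<times> nat"

definition value_of :: "colored_int \<Rightarrow> nat" where
  "value_of x = fst x"

definition colored_ints :: "nat \<Rightarrow> colored_int set" where
  "colored_ints n = (\<Union>b\<in>{1..2*n}. {(m, b) | m. b \<le> m \<and> (\<exists>r\<in>{b..2*b-1}. [m = r] (mod 2*n))})"

text \<open>\<open>tri n a b j\<close> is \<open>m\<^sub>a\<^sub>b(-j)\<close>, meaningful for \<open>1 \<le> a \<le> b \<le> 2n\<close> and \<open>j \<ge> 1\<close>, where the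
  truncated subtractions are exact. That these are exactly the elements of \<open>colored_ints n\<close>, each
  written uniquely, is the lemma \<open>bij_betw_tri\<close> below.\<close>

definition tri :: "nat \<Rightarrow> nat \<Rightarrow> nat \<Rightarrow> nat \<Rightarrow> colored_int" where
  "tri n a b j = (a + b - 1 + 2*n*(j - 1), b)"

definition tri_index :: "nat \<Rightarrow> nat \<Rightarrow> nat \<Rightarrow> bool" where
  "tri_index n a b \<longleftrightarrow> 1 \<le> a \<and> a \<le> b \<and> b \<le> 2*n"

lemma bij_betw_tri:
  assumes "n \<ge> 1"
  shows "bij_betw (\<lambda>(a, b, j). tri n a b j) {(a, b, j). tri_index n a b \<and> j \<ge> 1} (colored_ints n)"
proof (rule bij_betw_imageI)
  show "inj_on (\<lambda>(a, b, j). tri n a b j) {(a, b, j). tri_index n a b \<and> j \<ge> 1}"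
  proof (rule inj_onI)
    fix x y
    assume "x \<in> {(a, b, j). tri_index n a b \<and> j \<ge> 1}" "y \<in> {(a, b, j). tri_index n a b \<and> j \<ge> 1}"
      and eq: "(\<lambda>(a, b, j). tri n a b j) x = (\<lambda>(a, b, j). tri n a b j) y"
    then obtain a b j a' b' j' where xy: "x = (a, b, j)" "y = (a', b', j')"
      and t: "tri_index n a b" "tri_index n a' b'" "j \<ge> 1" "j' \<ge> 1"
      by blast
    from eq xy have bb: "b' = b" by (simp add: tri_def)
    have h: "1 \<le> a" "a \<le> b" "b \<le> 2*n" "1 \<le> a'" "a' \<le> b"
      using t bb by (simp_all add: tri_index_def)
    from eq xy bb have "a + b - 1 + 2*n*(j - 1) = a' + b - 1 + 2*n*(j' - 1)"
      by (simp add: tri_def)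
    with h have e: "(a - 1) + 2*n*(j - 1) = (a' - 1) + 2*n*(j' - 1)" by simp
    have lt: "a - 1 < 2*n" "a' - 1 < 2*n" using h by linarith+
    have "((a - 1) + 2*n*(j - 1)) mod (2*n) = a - 1"
      "((a' - 1) + 2*n*(j' - 1)) mod (2*n) = a' - 1" by (simp_all only: mod_mult_self2 mod_less lt)
    with e have aa: "a - 1 = a' - 1" by simp
    with e have "2*n*(j - 1) = 2*n*(j' - 1)" by simp
    then have "j - 1 = j' - 1" using assms by simp
    with aa h t have "a = a'" "j = j'" by linarith+
    with xy bb show "x = y" by simp
  qed
next
  show "(\<lambda>(a, b, j). tri n a b j) ` {(a, b, j). tri_index n a b \<and> j \<ge> 1} = colored_ints n"
  proof (intro equalityI subsetI)
    fix x assume "x \<in> (\<lambda>(a, b, j). tri n a b j) ` {(a, b, j). tri_index n a b \<and> j \<ge> 1}"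
    then obtain a b j where h: "x = tri n a b j" "1 \<le> a" "a \<le> b" "b \<le> 2*n" "j \<ge> 1"
      by (auto simp: tri_index_def)
    have "[a + b - 1 + 2*n*(j - 1) = a + b - 1] (mod 2*n)" by (simp add: cong_def)
    moreover have "a + b - 1 \<in> {b..2*b-1}" using h by auto
    moreover have "b \<in> {1..2*n}" "b \<le> a + b - 1 + 2*n*(j - 1)" using h by auto
    ultimately show "x \<in> colored_ints n" unfolding colored_ints_def h(1) tri_def by blast
  next
    fix x assume "x \<in> colored_ints n"
    then obtain m b r where h: "x = (m, b)" "1 \<le> b" "b \<le> 2*n" "b \<le> m" "b \<le> r" "r \<le> 2*b-1"
      "[m = r] (mod 2*n)" unfolding colored_ints_def by auto
    have r: "r - b < 2*n" using h by linarith
    have "[(m - b) + b = (r - b) + b] (mod 2*n)" using h by simp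
    then have "[m - b = r - b] (mod 2*n)" by (simp only: cong_add_rcancel_nat)
    then have "(m - b) mod (2*n) = r - b" using r by (simp add: cong_def)
    then have "m - b = (r - b) + 2*n*((m - b) div (2*n))"
      by (metis mod_mult_div_eq)
    then have "m = (r - b + 1) + b - 1 + 2*n*(((m - b) div (2*n) + 1) - 1)" using h by simp
    then have "x = tri n (r - b + 1) b ((m - b) div (2*n) + 1)"
      unfolding tri_def h(1) by simp
    moreover have "tri_index n (r - b + 1) b" using h by (auto simp: tri_index_def)
    ultimately show "x \<in> (\<lambda>(a, b, j). tri n a b j) ` {(a, b, j). tri_index n a b \<and> j \<ge> 1}"
      by force
  qed
qed

definition congruence_partitions :: "nat \<Rightarrow> nat \<Rightarrow> nat multiset set" where
  "congruence_partitions n N =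
    {p. (\<forall>m\<in>#p. m \<ge> 1) \<and> (\<Sum>m\<in>#p. m) = N \<and>
        (\<forall>m\<ge>1. [int m = 0] (mod int (2*n+4)) \<or> [int m = 2] (mod int (2*n+4)) \<or>
               [int m = -2] (mod int (2*n+4)) \<longrightarrow> count p m = 0)}"

definition colored_partitions :: "nat \<Rightarrow> nat \<Rightarrow> colored_int multiset set" where
  "colored_partitions n N = {p. set_mset p \<subseteq> colored_ints n \<and> (\<Sum>x\<in>#p. value_of x) = N}"

definition difference_conditions :: "nat \<Rightarrow> colored_int multiset \<Rightarrow> bool" where
  "difference_conditions n p \<longleftrightarrow>
    (\<forall>x\<in>colored_ints n. count p x \<le> 1) \<and>
    (\<forall>a b a' b' j. tri_index n a b \<and> tri_index n a' b' \<and> j \<ge> 1 \<and>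
       tri n a b (j+1) \<noteq> tri n a' b' j \<and> b \<le> a' \<longrightarrow>
       count p (tri n a b (j+1)) + count p (tri n a' b' j) \<le> 1) \<and>
    (\<forall>a b a' b' j. tri_index n a b \<and> tri_index n a' b' \<and> j \<ge> 1 \<and>
       tri n a b j \<noteq> tri n a' b' j \<and> b \<le> b' \<and> a \<ge> a' \<longrightarrow>
       count p (tri n a b j) + count p (tri n a' b' j) \<le> 1)"

end

theory Submission
  imports Defs "HOL-Computational_Algebra.Formal_Laurent_Series"
begin

text \<open>
  The triangles \<open>m\<^sub>a\<^sub>b(-j)\<close> can be glued, alternately upright and reflected, into the strip
  \<open>1 \<le> x \<le> y \<le> x + 2n\<close> of lattice points so that the value of a colored integer becomes \<open>x + y - 1\<close>
  and the two difference conditions merge into one: the points used by the partition must increase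
  strictly in both coordinates. Such a chain is the Frobenius symbol with arms \<open>y - 1\<close> and legs
  \<open>x - 1\<close>, so the colored partitions of \<open>N\<close> are the ordinary partitions of \<open>N\<close> all of whose successive
  ranks lie in \<open>[0, 2n]\<close>, and the claim is the Andrews-Bressoud theorem on successive ranks for
  modulus \<open>M = 2n + 4\<close>.

  Let \<open>G(x, y)\<close> be the generating function of the chains inside \<open>[1, x] \<times> [1, y]\<close>. Looking at
  the corner \<open>(x, y)\<close> yields a linear recurrence whose coefficients depend on \<open>x + y\<close> only
  (\<open>chain_gf_rec\<close>). The Gaussian binomial coefficient \<open>[x + y, x - s]\<close> solves it for every shift
  \<open>s\<close>, and the two edges of the strip impose \<open>G(x + 1, x) = G(x, x)\<close> and
  \<open>G(x, x + 2n + 1) = G(x, x + 2n)\<close>. Each edge condition pairs a shift with its mirror image: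
  \<open>s\<close> with \<open>2 - s\<close>, and \<open>s\<close> with \<open>-2n - 2 - s\<close>. Starting from the unrestricted solution \<open>s = 0\<close>, the
  method of images therefore produces an alternating sum over the orbit of \<open>0\<close> under these two
  reflections, whose composition translates by \<open>M\<close> (\<open>chain_gf_eq_image_sum\<close>).

  As \<open>x = y\<close> grows, every Gaussian binomial tends to \<open>1 / (q; q)\<^sub>\<infinity>\<close>, so the image sum tends to
  \<open>1 / (q; q)\<^sub>\<infinity>\<close> times the alternating theta series with exponents \<open>M j (j - 1) / 2 + 2 j\<close>, which the Jacobi
  triple product turns into the product of \<open>1 - q\<^sup>m\<close> over all \<open>m \<equiv> 0, \<plusminus>2 (mod M)\<close>. What remains of
  \<open>1 / (q; q)\<^sub>\<infinity>\<close> is the generating function of the partitions without such parts. No limit is taken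
  literally: everything is compared modulo \<open>q\<^bsup>N+1\<^esup>\<close> with finite products and a finite form of the triple
  product (\<open>finite_triple_product\<close>).
\<close>

section \<open>Laurent series modulo high powers of q\<close>

text \<open>The variable \<open>q\<close> is that of formal Laurent series, which make its powers units: the exponents
  arising from shifts and reflections can then be added without keeping track of their signs.\<close>

definition qpow :: "int \<Rightarrow> int fls" where
  "qpow i = fls_X_intpow i"

lemma qpow_0 [simp]: "qpow 0 = 1"
  by (simp add: qpow_def)

lemma qpow_mult: "qpow i * qpow j = qpow (i + j)"
  by (simp only: qpow_def fls_X_intpow_times_fls_X_intpow)

lemma qpow_mult_assoc: "qpow i * (qpow j * f) = qpow (i + j) * f"
  by (simp only: qpow_mult mult.assoc [symmetric])

lemma nth_qpow_mult: "fls_nth (qpow i * f) k = fls_nth f (k - i)"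
  by (simp add: qpow_def fls_X_intpow_times_conv_shift)

lemma nth_qpow: "fls_nth (qpow i) k = (if k = i then 1 else 0)"
  by (simp add: qpow_def)

text \<open>\<open>ord_ge d (f - g)\<close> is the congruence of \<open>f\<close> and \<open>g\<close> modulo \<open>q\<^sup>d\<close>; nonpositive \<open>d\<close> occur as
  harmless bounds for terms outside the range of a sum.\<close>

definition ord_ge :: "int \<Rightarrow> int fls \<Rightarrow> bool" where
  "ord_ge d f \<longleftrightarrow> (\<forall>i<d. fls_nth f i = 0)"

lemma ord_ge_mono: "ord_ge d f \<Longrightarrow> c \<le> d \<Longrightarrow> ord_ge c f"
  by (auto simp: ord_ge_def)

lemma ord_ge_0 [simp]: "ord_ge d 0"
  by (simp add: ord_ge_def)

lemma ord_ge_1: "ord_ge 0 1"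
  by (simp add: ord_ge_def)

lemma ord_ge_add: "ord_ge d f \<Longrightarrow> ord_ge d g \<Longrightarrow> ord_ge d (f + g)"
  by (auto simp: ord_ge_def)

lemma ord_ge_diff: "ord_ge d f \<Longrightarrow> ord_ge d g \<Longrightarrow> ord_ge d (f - g)"
  by (auto simp: ord_ge_def)

lemma ord_ge_uminus: "ord_ge d f \<Longrightarrow> ord_ge d (- f)"
  by (auto simp: ord_ge_def)

lemma ord_ge_qpow: "ord_ge i (qpow i)"
  by (auto simp: ord_ge_def nth_qpow)

lemma ord_ge_mult:
  assumes "ord_ge c f" "ord_ge d g"
  shows "ord_ge (c + d) (f * g)"
proof (cases "f = 0 \<or> g = 0")
  case False
  then have "c \<le> fls_subdegree f" "d \<le> fls_subdegree g"
    using assms by (auto intro: fls_subdegree_geI simp: ord_ge_def)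
  then show ?thesis
    unfolding ord_ge_def by (auto intro!: fls_times_nth_eq0)
qed auto

lemma ord_ge_mult_left: "ord_ge 0 f \<Longrightarrow> ord_ge d g \<Longrightarrow> ord_ge d (f * g)"
  using ord_ge_mult [of 0 f d g] by simp

lemma ord_ge_sum: "(\<And>x. x \<in> A \<Longrightarrow> ord_ge d (f x)) \<Longrightarrow> ord_ge d (sum f A)"
  by (induction A rule: infinite_finite_induct) (auto intro: ord_ge_add)

lemma ord_ge_one_minus_qpow: "0 \<le> i \<Longrightarrow> ord_ge 0 (1 - qpow i)"
  by (intro ord_ge_diff ord_ge_1 ord_ge_mono [OF ord_ge_qpow])

lemma ord_ge_prod_0: "(\<And>x. x \<in> A \<Longrightarrow> ord_ge 0 (f x)) \<Longrightarrow> ord_ge 0 (prod f A)"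
  by (induction A rule: infinite_finite_induct) (auto intro: ord_ge_1 ord_ge_mult_left)

lemma ord_ge_mult_one:
  assumes "ord_ge 0 f" "ord_ge d (f - 1)" "ord_ge d (g - 1)"
  shows "ord_ge d (f * g - 1)"
proof -
  have eq: "f * g - 1 = f * (g - 1) + (f - 1)" by (simp add: algebra_simps)
  show ?thesis unfolding eq by (intro ord_ge_add ord_ge_mult_left assms)
qed

lemma ord_ge_prod_one_minus:
  assumes "\<And>x. x \<in> A \<Longrightarrow> d \<le> e x" "0 \<le> d"
  shows "ord_ge d ((\<Prod>x\<in>A. 1 - qpow (e x)) - 1)"
  using assms
proof (induction A rule: infinite_finite_induct)
  case (insert x F)
  have "ord_ge d (qpow (e x))" "0 \<le> e x"
    using insert.prems(1)[of x] insert.prems(2) by (auto intro: ord_ge_mono [OF ord_ge_qpow])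
  then show ?case
    using insert by (auto intro!: ord_ge_mult_one ord_ge_one_minus_qpow simp: ord_ge_uminus)
qed auto

section \<open>Gaussian binomial coefficients\<close>

text \<open>The Gaussian binomial coefficient in base \<open>q\<^sup>w\<close>. The lower index is an integer, so that a shifted
  coefficient is again one and simply vanishes when the shift leads out of range.\<close>

fun qbin :: "int \<Rightarrow> nat \<Rightarrow> int \<Rightarrow> int fls" where
  "qbin w 0 k = (if k = 0 then 1 else 0)"
| "qbin w (Suc m) k = qbin w m (k - 1) + qpow (w * k) * qbin w m k"

lemma qbin_eq_0: "k < 0 \<or> int m < k \<Longrightarrow> qbin w m k = 0"
  by (induction m arbitrary: k) auto

lemma qbin_Suc_dual:
  "qbin w (Suc m) k = qbin w m k + qpow (w * (int m + 1 - k)) * qbin w m (k - 1)"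
proof (induction m arbitrary: k)
  case (Suc m)
  have "qbin w (Suc (Suc m)) k = qbin w (Suc m) (k - 1) + qpow (w * k) * qbin w (Suc m) k"
    by simp
  also have "\<dots> = (qbin w m (k - 1) + qpow (w * k) * qbin w m k)
      + (qpow (w * (int m + 2 - k)) * qbin w m (k - 2)
         + qpow (w * k + w * (int m + 1 - k)) * qbin w m (k - 1))"
    unfolding Suc.IH by (simp add: algebra_simps qpow_mult_assoc qpow_mult)
  also have "\<dots> = qbin w (Suc m) k + qpow (w * (int (Suc m) + 1 - k)) * qbin w (Suc m) (k - 1)"
    by (simp add: algebra_simps qpow_mult_assoc qpow_mult)
  finally show ?case .
qed auto

lemma qbin_sym: "qbin w m (int m - k) = qbin w m k"
proof (induction m arbitrary: k)
  case (Suc m)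
  have eqs: "int (Suc m) - k = int m - (k - 1)" "int m - (k - 1) - 1 = int m - k"
    "int m + 1 - k = int m - (k - 1)" by auto
  show ?case unfolding qbin_Suc_dual [of w m k] by (simp only: eqs qbin.simps Suc.IH)
qed auto

text \<open>Comparing the two Pascal rules, after multiplying the dual one by \<open>q\<^bsup>wk\<^esup>\<close>.\<close>

lemma qbin_absorb:
  "(1 - qpow (w * k)) * qbin w (Suc m) k = (1 - qpow (w * (int m + 1))) * qbin w m (k - 1)"
proof -
  have "qpow (w * k) * qbin w (Suc m) k
      = qpow (w * k) * qbin w m k + qpow (w * (int m + 1)) * qbin w m (k - 1)"
    unfolding qbin_Suc_dual by (simp add: algebra_simps qpow_mult_assoc qpow_mult)
  then show ?thesis by (simp add: algebra_simps)
qed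

text \<open>The recurrence that the generating function of chains satisfies: the factor \<open>1 - q\<^bsup>w(m+1)\<^esup>\<close> does not
  see \<open>k\<close>, hence all shifts in \<open>k\<close> solve one and the same recurrence.\<close>

lemma qbin_cross:
  "qbin w (Suc (Suc m)) k = qbin w (Suc m) (k - 1) + qbin w (Suc m) k
     - (1 - qpow (w * (int m + 1))) * qbin w m (k - 1)"
  unfolding qbin_absorb [symmetric] qbin.simps(2) [of w "Suc m"] by (simp add: algebra_simps)

definition qfac :: "int \<Rightarrow> nat \<Rightarrow> int fls" where
  "qfac w m = (\<Prod>j\<in>{1..m}. 1 - qpow (w * int j))"

lemma qfac_Suc: "qfac w (Suc m) = qfac w m * (1 - qpow (w * (int m + 1)))"
  by (simp add: qfac_def add.commute)

lemma qfac_split: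
  assumes "k \<le> m"
  shows "qfac w m = qfac w k * (\<Prod>j\<in>{k+1..m}. 1 - qpow (w * int j))"
proof -
  have "{1..m} = {1..k} \<union> {k+1..m}" using assms by auto
  then show ?thesis unfolding qfac_def by (simp add: prod.union_disjoint)
qed

lemma qbin_mult_qfac:
  assumes "k \<le> m"
  shows "qbin w m (int k) * qfac w k = (\<Prod>j\<in>{m-k+1..m}. 1 - qpow (w * int j))"
  using assms
proof (induction k arbitrary: m)
  case 0
  have "qbin w m 0 = 1" by (induction m) (auto simp: qbin_eq_0)
  then show ?case by (simp add: qfac_def)
next
  case (Suc k)
  then obtain m' where m: "m = Suc m'" "k \<le> m'" by (cases m) auto
  have "qbin w m (int (Suc k)) * qfac w (Suc k)
      = ((1 - qpow (w * int (Suc k))) * qbin w (Suc m') (int (Suc k))) * qfac w k"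
    by (simp add: m qfac_Suc algebra_simps)
  also have "\<dots> = (1 - qpow (w * (int m' + 1))) * (qbin w m' (int k) * qfac w k)"
    unfolding qbin_absorb by (simp add: mult.assoc)
  also have "\<dots> = (1 - qpow (w * (int m' + 1))) * (\<Prod>j\<in>{m'-k+1..m'}. 1 - qpow (w * int j))"
    by (simp only: Suc.IH [OF m(2)])
  also have "\<dots> = (\<Prod>j\<in>{m - Suc k + 1..m}. 1 - qpow (w * int j))"
    using m by (simp add: prod.nat_ivl_Suc' mult.commute add.commute)
  finally show ?case .
qed

text \<open>The coefficient times \<open>(q\<^sup>w; q\<^sup>w)\<^sub>m\<close> is a product of factors \<open>1 - q\<^bsup>wj\<^esup>\<close> with \<open>j > min k (m - k)\<close>. If \<open>k\<close> is out of
  range, then the order claimed is at most \<open>0\<close>; admitting this case spares a distinction in the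
  estimates of whole sums below.\<close>

lemma ord_ge_qbin_qfac:
  assumes "1 \<le> w"
  shows "ord_ge (w * (min k (int m - k) + 1)) (qbin w m k * qfac w m - 1)"
proof (cases "0 \<le> k \<and> k \<le> int m")
  case True
  then obtain k' where k: "k = int k'" "k' \<le> m" by (metis nat_0_le nat_le_iff)
  have eq: "qbin w m k * qfac w m
      = (\<Prod>j\<in>{m-k'+1..m}. 1 - qpow (w * int j)) * (\<Prod>j\<in>{k'+1..m}. 1 - qpow (w * int j))"
    using qbin_mult_qfac [OF k(2), of w] qfac_split [OF k(2), of w]
    by (simp add: k(1) mult.assoc [symmetric])
  let ?d = "w * (min k (int m - k) + 1)"
  have le: "?d \<le> w * int j" if "j \<in> {m-k'+1..m} \<or> j \<in> {k'+1..m}" for j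
    using that k assms by (intro mult_left_mono) auto
  have "0 \<le> ?d" using assms True by simp
  then show ?thesis
    unfolding eq using le assms
    by (intro ord_ge_mult_one ord_ge_prod_one_minus ord_ge_prod_0 ord_ge_one_minus_qpow) auto
next
  case False
  have "w * (min k (int m - k) + 1) \<le> 0"
    using False assms by (intro mult_nonneg_nonpos) auto
  then show ?thesis
    using False by (auto simp: qbin_eq_0 intro!: ord_ge_uminus ord_ge_mono [OF ord_ge_1])
qed

section \<open>A finite Jacobi triple product\<close>

definition alt :: "int \<Rightarrow> int fls" where
  "alt j = (if even j then 1 else - 1)"

lemma alt_Suc: "alt (j + 1) = - alt j"
  by (simp add: alt_def)

definition theta :: "int \<Rightarrow> int \<Rightarrow> int \<Rightarrow> int" where
  "theta w a j = w * (j * (j - 1) div 2) + a * j"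

text \<open>The increments of \<open>theta\<close> are linear; this is what lets a shift of the summation index absorb
  the powers of \<open>q\<close> in the Pascal rules.\<close>

lemma theta_Suc: "theta w a (j + 1) = theta w a j + w * j + a"
proof -
  have "(j + 1) * j = j * (j - 1) + j * 2" by (simp add: algebra_simps)
  then have "(j + 1) * j div 2 = j * (j - 1) div 2 + j"
    by (metis div_mult_self1 add.commute zero_neq_numeral)
  then show ?thesis by (simp add: theta_def algebra_simps)
qed

lemma sum_int_shift:
  fixes g :: "int \<Rightarrow> 'a::comm_monoid_add"
  assumes "lo \<le> hi" "g lo = 0" "g (hi + 1) = 0"
  shows "(\<Sum>j\<in>{lo..hi}. g (j + 1)) = (\<Sum>j\<in>{lo..hi}. g j)"
proof -
  have "(\<Sum>j\<in>{lo..hi}. g (j + 1)) = (\<Sum>j\<in>{lo+1..hi+1}. g j)"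
    by (rule sum.reindex_bij_witness [of _ "\<lambda>j. j - 1" "\<lambda>j. j + 1"]) auto
  also have "\<dots> = (\<Sum>j\<in>{lo+1..hi}. g j)"
  proof (intro sum.mono_neutral_right ballI)
    fix i assume "i \<in> {lo+1..hi+1} - {lo+1..hi}"
    then have "i = hi + 1" by auto
    then show "g i = 0" using assms by simp
  qed auto
  also have "\<dots> = (\<Sum>j\<in>{lo..hi}. g j)"
  proof (intro sum.mono_neutral_left ballI)
    fix i assume "i \<in> {lo..hi} - {lo+1..hi}"
    then have "i = lo" by auto
    then show "g i = 0" using assms by simp
  qed auto
  finally show ?thesis .
qed

text \<open>The theta series weighted with a row of Gaussian binomials. The summation interval is a
  parameter; the lemmas require it to cover the support of the row with room for one shift.\<close>

definition theta_sum :: "int \<Rightarrow> int \<Rightarrow> int \<Rightarrow> int \<Rightarrow> nat \<Rightarrow> int \<Rightarrow> int fls" where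
  "theta_sum w a lo hi m c = (\<Sum>j\<in>{lo..hi}. alt j * qpow (theta w a j) * qbin w m (c + j))"

text \<open>Raising the row multiplies the sum by one factor of the triple product: the dual Pascal rule
  adds a copy of the summand shifted by one. The ordinary rule does the same in \<open>theta_sum_down\<close> for
  the factors with inverted variable.\<close>

lemma theta_sum_up:
  assumes "lo \<le> hi" "lo < - c" "int m - c < hi"
  shows "theta_sum w a lo hi m c * (1 - qpow (a + w * (int m - c)))
       = theta_sum w a lo hi (Suc m) c"
proof -
  let ?g = "\<lambda>j. alt j * qpow (theta w a j + w * (int m - (c + j) + 1)) * qbin w m (c + j - 1)"
  have shift: "(\<Sum>j\<in>{lo..hi}. ?g (j + 1)) = (\<Sum>j\<in>{lo..hi}. ?g j)"
    using assms by (intro sum_int_shift) (auto simp: qbin_eq_0)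
  have g: "?g (j + 1) = - (alt j * qpow (theta w a j) * qbin w m (c + j) * qpow (a + w * (int m - c)))" for j
  proof -
    have "theta w a (j + 1) + w * (int m - (c + (j + 1)) + 1) = theta w a j + (a + w * (int m - c))"
      unfolding theta_Suc by (simp add: algebra_simps)
    then show ?thesis
      by (simp only: alt_Suc qpow_mult [symmetric]) (simp add: algebra_simps)
  qed
  have "theta_sum w a lo hi (Suc m) c
      = (\<Sum>j\<in>{lo..hi}. alt j * qpow (theta w a j) * qbin w m (c + j) + ?g j)"
    unfolding theta_sum_def qbin_Suc_dual
    by (intro sum.cong refl) (simp add: algebra_simps qpow_mult_assoc qpow_mult)
  also have "\<dots> = theta_sum w a lo hi m c + (\<Sum>j\<in>{lo..hi}. ?g (j + 1))"
    unfolding sum.distrib shift theta_sum_def ..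
  also have "(\<Sum>j\<in>{lo..hi}. ?g (j + 1)) = - (theta_sum w a lo hi m c * qpow (a + w * (int m - c)))"
    unfolding g sum_negf theta_sum_def sum_distrib_right ..
  finally show ?thesis by (simp add: algebra_simps)
qed

lemma theta_sum_down:
  assumes "lo \<le> hi" "lo < - c" "int m - c < hi"
  shows "theta_sum w a lo hi m c * (1 - qpow (w * (c + 1) - a))
       = theta_sum w a lo hi (Suc m) (c + 1)"
proof -
  let ?g = "\<lambda>j. alt j * qpow (theta w a j + (w * (c + 1) - a)) * qbin w m (c + j)"
  have shift: "(\<Sum>j\<in>{lo..hi}. ?g (j + 1)) = (\<Sum>j\<in>{lo..hi}. ?g j)"
    using assms by (intro sum_int_shift) (auto simp: qbin_eq_0)
  have g: "- ?g (j + 1) = alt j * qpow (theta w a j) * (qpow (w * (c + 1 + j)) * qbin w m (c + 1 + j))" for j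
  proof -
    have "theta w a (j + 1) + (w * (c + 1) - a) = theta w a j + w * (c + 1 + j)"
      unfolding theta_Suc by (simp add: algebra_simps)
    then show ?thesis
      by (simp only: alt_Suc qpow_mult [symmetric]) (simp add: algebra_simps)
  qed
  have "theta_sum w a lo hi (Suc m) (c + 1)
      = (\<Sum>j\<in>{lo..hi}. alt j * qpow (theta w a j) * qbin w m (c + j) + - ?g (j + 1))"
    unfolding theta_sum_def g qbin.simps
    by (intro sum.cong refl) (simp add: algebra_simps)
  also have "\<dots> = theta_sum w a lo hi m c - (\<Sum>j\<in>{lo..hi}. ?g (j + 1))"
    unfolding sum.distrib sum_negf theta_sum_def by simp
  also have "(\<Sum>j\<in>{lo..hi}. ?g (j + 1)) = theta_sum w a lo hi m c * qpow (w * (c + 1) - a)"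
    unfolding shift unfolding theta_sum_def sum_distrib_right qpow_mult [symmetric]
    by (intro sum.cong refl) (simp only: mult_ac)
  finally show ?thesis by (simp add: algebra_simps)
qed

text \<open>Alternating the two steps builds the triple product one pair of factors at a time.\<close>

theorem finite_triple_product:
  assumes "lo < - int L" "int L < hi"
  shows "theta_sum w a lo hi (2 * L) (int L)
       = (\<Prod>k\<in>{0..<L}. 1 - qpow (a + w * int k)) * (\<Prod>k\<in>{1..L}. 1 - qpow (w * int k - a))"
  using assms
proof (induction L)
  case 0
  have "theta_sum w a lo hi 0 0 = (\<Sum>j\<in>{0}. alt j * qpow (theta w a j) * qbin w 0 j)"
    unfolding theta_sum_def using 0 by (intro sum.mono_neutral_cong_right) auto
  then show ?case by (simp add: alt_def theta_def)
next
  case (Suc L)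
  let ?F = "theta_sum w a lo hi"
  have "?F (2 * Suc L) (int (Suc L)) = ?F (Suc (Suc (2 * L))) (int L + 1)"
    by (simp add: add.commute)
  also have "\<dots> = ?F (Suc (2 * L)) (int L) * (1 - qpow (w * (int L + 1) - a))"
    using Suc.prems by (intro theta_sum_down [symmetric]) auto
  also have "?F (Suc (2 * L)) (int L) = ?F (2 * L) (int L) * (1 - qpow (a + w * (int (2 * L) - int L)))"
    using Suc.prems by (intro theta_sum_up [symmetric]) auto
  also have "?F (2 * L) (int L)
      = (\<Prod>k\<in>{0..<L}. 1 - qpow (a + w * int k)) * (\<Prod>k\<in>{1..L}. 1 - qpow (w * int k - a))"
    using Suc by auto
  finally show ?case
    by (simp add: add.commute mult_ac)
qed

section \<open>Strict chains of lattice points in a strip\<close>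

definition strip :: "nat \<Rightarrow> (nat \<times> nat) set" where
  "strip n = {(x, y). 1 \<le> x \<and> x \<le> y \<and> y \<le> x + 2 * n}"

definition comparable :: "nat \<times> nat \<Rightarrow> nat \<times> nat \<Rightarrow> bool" where
  "comparable u v \<longleftrightarrow>
     fst u < fst v \<and> snd u < snd v \<or> fst v < fst u \<and> snd v < snd u"

text \<open>Chains of points inside the rectangle \<open>[1, x] \<times> [1, y]\<close>; the lower bounds come from the strip.\<close>

definition chains :: "nat \<Rightarrow> nat \<Rightarrow> nat \<Rightarrow> (nat \<times> nat) set set" where
  "chains n x y = {C. C \<subseteq> strip n \<inter> {..x} \<times> {..y} \<and> pairwise comparable C}"

text \<open>The length of the hook with leg \<open>fst u - 1\<close> and arm \<open>snd u - 1\<close>.\<close>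

definition hook :: "nat \<times> nat \<Rightarrow> nat" where
  "hook u = fst u + snd u - 1"

definition chain_gf :: "nat \<Rightarrow> nat \<Rightarrow> nat \<Rightarrow> int fls" where
  "chain_gf n x y = (\<Sum>C\<in>chains n x y. qpow (int (\<Sum>u\<in>C. hook u)))"

lemma finite_chains: "finite (chains n x y)"
  by (rule finite_subset [of _ "Pow ({..x} \<times> {..y})"]) (auto simp: chains_def)

lemma finite_chain: "C \<in> chains n x y \<Longrightarrow> finite C"
  by (rule finite_subset [of _ "{..x} \<times> {..y}"]) (auto simp: chains_def)

lemma chain_gf_0: "chain_gf n 0 y = 1"
proof -
  have "chains n 0 y = {{}}" by (auto simp: chains_def strip_def)
  then show ?thesis by (simp add: chain_gf_def)
qed

text \<open>The enlarged rectangle gains only points outside the strip. This and the next lemma are the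
  boundary conditions on the two edges of the strip.\<close>

lemma chain_gf_diag: "chain_gf n (Suc x) x = chain_gf n x x"
proof -
  have "strip n \<inter> {..Suc x} \<times> {..x} = strip n \<inter> {..x} \<times> {..x}"
    by (auto simp: strip_def)
  then show ?thesis by (simp add: chain_gf_def chains_def)
qed

lemma chain_gf_far: "chain_gf n x (x + 2 * n + 1) = chain_gf n x (x + 2 * n)"
proof -
  have "strip n \<inter> {..x} \<times> {..x + 2 * n + 1} = strip n \<inter> {..x} \<times> {..x + 2 * n}"
    by (auto simp: strip_def)
  then show ?thesis by (simp add: chain_gf_def chains_def)
qed

text \<open>A chain that avoids the corner cannot meet both the last column and the last row, because a point
  of each would be incomparable; a chain that contains the corner has all its other points below
  and to the left of it.\<close>

lemma chains_Suc:
  assumes "(Suc x, Suc y) \<in> strip n"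
  shows "chains n (Suc x) (Suc y)
       = (chains n x (Suc y) \<union> chains n (Suc x) y) \<union> insert (Suc x, Suc y) ` chains n x y"
    (is "?L = ?R")
proof (rule set_eqI, rule iffI)
  fix C assume C: "C \<in> ?L"
  show "C \<in> ?R"
  proof (cases "(Suc x, Suc y) \<in> C")
    case True
    have "u \<in> {..x} \<times> {..y}" if "u \<in> C - {(Suc x, Suc y)}" for u
    proof -
      have "comparable u (Suc x, Suc y)"
        using C True that by (auto simp: chains_def pairwise_def)
      moreover have "u \<in> {..Suc x} \<times> {..Suc y}" using C that by (auto simp: chains_def)
      ultimately show ?thesis by (cases u) (auto simp: comparable_def)
    qed
    then have "C - {(Suc x, Suc y)} \<in> chains n x y"
      using C by (auto simp: chains_def pairwise_def)
    then show ?thesis using True by (metis UnI2 image_eqI insert_Diff)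
  next
    case False
    have "C \<in> chains n x (Suc y)" if "\<And>u. u \<in> C \<Longrightarrow> fst u \<noteq> Suc x"
    proof -
      have "C \<subseteq> {..x} \<times> {..Suc y}"
        using C that by (fastforce simp: chains_def le_Suc_eq)
      then show ?thesis using C by (auto simp: chains_def)
    qed
    moreover have "C \<in> chains n (Suc x) y" if "\<And>u. u \<in> C \<Longrightarrow> snd u \<noteq> Suc y"
    proof -
      have "C \<subseteq> {..Suc x} \<times> {..y}"
        using C that by (fastforce simp: chains_def le_Suc_eq)
      then show ?thesis using C by (auto simp: chains_def)
    qed
    moreover have "False" if uv: "u \<in> C" "fst u = Suc x" "v \<in> C" "snd v = Suc y" for u v
    proof -
      have "u \<noteq> v" using False uv by (metis prod.collapse)
      then have "comparable u v" using C uv by (auto simp: chains_def pairwise_def)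
      moreover have "fst v \<le> Suc x" "snd u \<le> Suc y" using C uv by (auto simp: chains_def)
      ultimately show False using uv by (auto simp: comparable_def)
    qed
    ultimately show ?thesis by blast
  qed
next
  fix C assume C: "C \<in> ?R"
  have "chains n x (Suc y) \<subseteq> ?L" "chains n (Suc x) y \<subseteq> ?L" by (auto simp: chains_def)
  moreover have "insert (Suc x, Suc y) D \<in> ?L" if "D \<in> chains n x y" for D
  proof -
    have D: "D \<subseteq> {..x} \<times> {..y}" using that by (auto simp: chains_def)
    then have "comparable (Suc x, Suc y) u \<and> comparable u (Suc x, Suc y)" if "u \<in> D" for u
      using that by (force simp: comparable_def less_Suc_eq_le)
    then have "pairwise comparable (insert (Suc x, Suc y) D)"
      using that by (auto simp: chains_def pairwise_insert)
    then show ?thesis using that assms D by (auto simp: chains_def)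
  qed
  ultimately show "C \<in> ?L" using C by blast
qed

lemma chain_gf_rec:
  assumes "(Suc x, Suc y) \<in> strip n"
  shows "chain_gf n (Suc x) (Suc y) = chain_gf n x (Suc y) + chain_gf n (Suc x) y
     - (1 - qpow (int (x + y + 1))) * chain_gf n x y"
proof -
  let ?p = "(Suc x, Suc y)"
  let ?g = "\<lambda>C. qpow (int (\<Sum>u\<in>C. hook u))"
  have p: "?p \<notin> C" if "C \<in> chains n x y" for C
    using that by (auto simp: chains_def)
  have "inj_on (insert ?p) (chains n x y)"
    using p by (meson inj_onI insert_ident)
  then have "(\<Sum>C\<in>insert ?p ` chains n x y. ?g C) = (\<Sum>C\<in>chains n x y. ?g (insert ?p C))"
    by (simp add: sum.reindex)
  also have "\<dots> = (\<Sum>C\<in>chains n x y. qpow (int (x + y + 1)) * ?g C)"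
    using p by (intro sum.cong refl) (simp add: finite_chain qpow_mult hook_def algebra_simps)
  finally have ins: "(\<Sum>C\<in>insert ?p ` chains n x y. ?g C) = qpow (int (x + y + 1)) * chain_gf n x y"
    by (simp add: chain_gf_def sum_distrib_left)
  have "chains n x (Suc y) \<inter> chains n (Suc x) y = chains n x y"
    by (fastforce simp: chains_def)
  then have un: "(\<Sum>C\<in>chains n x (Suc y) \<union> chains n (Suc x) y. ?g C)
      = chain_gf n x (Suc y) + chain_gf n (Suc x) y - chain_gf n x y"
    unfolding chain_gf_def by (subst sum_Un) (simp_all add: finite_chains)
  have "(chains n x (Suc y) \<union> chains n (Suc x) y) \<inter> insert ?p ` chains n x y = {}"
    by (auto simp: chains_def)
  then have "chain_gf n (Suc x) (Suc y)
      = (\<Sum>C\<in>chains n x (Suc y) \<union> chains n (Suc x) y. ?g C)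
        + (\<Sum>C\<in>insert ?p ` chains n x y. ?g C)"
    unfolding chain_gf_def chains_Suc [OF assms]
    by (intro sum.union_disjoint) (simp_all add: finite_chains)
  then show ?thesis unfolding ins un by (simp add: algebra_simps)
qed

section \<open>The method of images\<close>

lemma theta_even: "theta w a (- 2 * t) = w * (t * (2 * t + 1)) - 2 * a * t"
proof -
  have "(- 2 * t) * (- 2 * t - 1) = 2 * (t * (2 * t + 1))" by (simp add: algebra_simps)
  then have "(- 2 * t) * (- 2 * t - 1) div 2 = t * (2 * t + 1)" by (metis nonzero_mult_div_cancel_left zero_neq_numeral)
  then show ?thesis by (simp add: theta_def)
qed

lemma theta_odd: "theta w a (1 - 2 * t) = w * (t * (2 * t - 1)) + a * (1 - 2 * t)"
proof -
  have "(1 - 2 * t) * (1 - 2 * t - 1) = 2 * (t * (2 * t - 1))" by (simp add: algebra_simps)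
  then have "(1 - 2 * t) * (1 - 2 * t - 1) div 2 = t * (2 * t - 1)" by (metis nonzero_mult_div_cancel_left zero_neq_numeral)
  then show ?thesis by (simp add: theta_def)
qed

text \<open>The images of the source \<open>0\<close> are the shifts \<open>M t\<close> with sign \<open>+\<close> and \<open>2 - M t\<close> with sign \<open>-\<close>. Their weights,
  forced by the edge conditions, are the terms of the theta series with even and with odd index.\<close>

definition image_even :: "int \<Rightarrow> int \<Rightarrow> nat \<Rightarrow> nat \<Rightarrow> int fls" where
  "image_even M t x y = qpow (theta M 2 (- 2 * t)) * qbin 1 (x + y) (int x - M * t)"

definition image_odd :: "int \<Rightarrow> int \<Rightarrow> nat \<Rightarrow> nat \<Rightarrow> int fls" where
  "image_odd M t x y = qpow (theta M 2 (1 - 2 * t)) * qbin 1 (x + y) (int x - 2 + M * t)"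

definition image_sum :: "int \<Rightarrow> int \<Rightarrow> nat \<Rightarrow> nat \<Rightarrow> int fls" where
  "image_sum M T x y = (\<Sum>t\<in>{-T..T}. image_even M t x y - image_odd M t x y)"

lemma image_even_rec:
  "image_even M t (Suc x) (Suc y) = image_even M t x (Suc y) + image_even M t (Suc x) y
     - (1 - qpow (int (x + y + 1))) * image_even M t x y"
proof -
  have "qbin 1 (Suc x + Suc y) (int (Suc x) - M * t) = qbin 1 (x + Suc y) (int x - M * t)
      + qbin 1 (Suc x + y) (int (Suc x) - M * t) - (1 - qpow (int (x + y + 1))) * qbin 1 (x + y) (int x - M * t)"
    using qbin_cross [of 1 "x + y" "int (Suc x) - M * t"] by (simp del: qbin.simps add: algebra_simps)
  then show ?thesis unfolding image_even_def by (simp only:) (simp only: algebra_simps)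
qed

lemma image_odd_rec:
  "image_odd M t (Suc x) (Suc y) = image_odd M t x (Suc y) + image_odd M t (Suc x) y
     - (1 - qpow (int (x + y + 1))) * image_odd M t x y"
proof -
  have "qbin 1 (Suc x + Suc y) (int (Suc x) - 2 + M * t) = qbin 1 (x + Suc y) (int x - 2 + M * t)
      + qbin 1 (Suc x + y) (int (Suc x) - 2 + M * t) - (1 - qpow (int (x + y + 1))) * qbin 1 (x + y) (int x - 2 + M * t)"
    using qbin_cross [of 1 "x + y" "int (Suc x) - 2 + M * t"] by (simp del: qbin.simps add: algebra_simps)
  then show ?thesis unfolding image_odd_def by (simp only:) (simp only: algebra_simps)
qed

lemma image_sum_rec:
  "image_sum M T (Suc x) (Suc y) = image_sum M T x (Suc y) + image_sum M T (Suc x) y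
     - (1 - qpow (int (x + y + 1))) * image_sum M T x y"
  unfolding image_sum_def image_even_rec image_odd_rec
  by (simp add: sum.distrib sum_subtractf sum_distrib_left algebra_simps)

text \<open>Along this edge the increment of every even image is cancelled by that of the odd image with the
  same \<open>t\<close>, its mirror image under \<open>s \<mapsto> 2 - s\<close>, because Gaussian binomials are symmetric.\<close>

lemma image_sum_diag: "image_sum M T (Suc x) x = image_sum M T x x"
proof -
  have "image_even M t (Suc x) x - image_even M t x x = image_odd M t (Suc x) x - image_odd M t x x" for t
  proof -
    have "image_even M t (Suc x) x - image_even M t x x
        = qpow (theta M 2 (- 2 * t) + (int x + 1 - M * t)) * qbin 1 (x + x) (int x + 1 - M * t)"
      by (simp add: image_even_def algebra_simps qpow_mult_assoc)
    also have "theta M 2 (- 2 * t) + (int x + 1 - M * t) = theta M 2 (1 - 2 * t) + (int x - 1 + M * t)"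
      unfolding theta_even theta_odd by (simp add: algebra_simps)
    also have "qbin 1 (x + x) (int x + 1 - M * t) = qbin 1 (x + x) (int x - 1 + M * t)"
      by (subst qbin_sym [symmetric]) (simp add: algebra_simps)
    also have "qpow (theta M 2 (1 - 2 * t) + (int x - 1 + M * t)) * qbin 1 (x + x) (int x - 1 + M * t)
        = image_odd M t (Suc x) x - image_odd M t x x"
      by (simp add: image_odd_def algebra_simps qpow_mult_assoc qpow_mult)
    finally show ?thesis .
  qed
  then have "image_even M t (Suc x) x - image_odd M t (Suc x) x = image_even M t x x - image_odd M t x x" for t
    by (simp add: algebra_simps)
  then show ?thesis by (simp add: image_sum_def)
qed

text \<open>Along the other edge the mirror image of the even image \<open>t\<close> is the odd image \<open>t + 1\<close>. In the truncated
  sum one image at either end stays unpaired; it vanishes since \<open>T\<close> is large.\<close>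

lemma image_sum_far:
  assumes "M = 2 * int n + 4" "2 * x + 2 * n < nat T"
  shows "image_sum M T x (x + 2 * n + 1) = image_sum M T x (x + 2 * n)"
proof -
  let ?m = "x + (x + 2 * n)"
  let ?h = "\<lambda>t. qpow (theta M 2 (1 - 2 * t) + (int x + 2 * int n + 3 - M * t)) * qbin 1 ?m (int x - 3 + M * t)"
  have MT: "T \<le> M * T" using assms mult_right_mono [of 1 M T] by simp
  have odd: "image_odd M t x (x + 2 * n + 1) - image_odd M t x (x + 2 * n) = ?h t" for t
    using qbin_Suc_dual [of 1 ?m "int x - 2 + M * t"]
    by (simp add: image_odd_def algebra_simps qpow_mult_assoc del: qbin.simps)
  have even: "image_even M t x (x + 2 * n + 1) - image_even M t x (x + 2 * n) = ?h (t + 1)" for t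
  proof -
    have "image_even M t x (x + 2 * n + 1) - image_even M t x (x + 2 * n)
       = qpow (theta M 2 (- 2 * t) + (int x + 2 * int n + 1 + M * t)) * qbin 1 ?m (int x - 1 - M * t)"
      using qbin_Suc_dual [of 1 ?m "int x - M * t"]
      by (simp add: image_even_def algebra_simps qpow_mult_assoc del: qbin.simps)
    also have "qbin 1 ?m (int x - 1 - M * t) = qbin 1 ?m (int x - 3 + M * (t + 1))"
      by (subst qbin_sym [symmetric]) (simp add: assms(1) algebra_simps)
    also have "theta M 2 (- 2 * t) + (int x + 2 * int n + 1 + M * t)
       = theta M 2 (1 - 2 * (t + 1)) + (int x + 2 * int n + 3 - M * (t + 1))"
      unfolding theta_even theta_odd by (simp add: assms(1) algebra_simps)
    finally show ?thesis .
  qed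
  have "(\<Sum>t\<in>{-T..T}. ?h (t + 1)) = (\<Sum>t\<in>{-T..T}. ?h t)"
  proof (rule sum_int_shift)
    have "int x - 3 + M * - T < 0" "int x - 3 + M * (T + 1) > int ?m"
      using assms MT by (simp_all add: distrib_left)
    then show "?h (- T) = 0" "?h (T + 1) = 0" by (simp_all only: qbin_eq_0 simp_thms mult_zero_right)
  qed (use assms in simp)
  then have "(\<Sum>t\<in>{-T..T}. (image_even M t x (x + 2 * n + 1) - image_even M t x (x + 2 * n))
      - (image_odd M t x (x + 2 * n + 1) - image_odd M t x (x + 2 * n))) = 0"
    unfolding even odd by (simp add: sum_subtractf)
  then show ?thesis
    unfolding image_sum_def sum_subtractf by (simp add: algebra_simps)
qed

lemma image_sum_0:
  assumes "M = 2 * int n + 4" "y \<le> 2 * n + 1" "0 \<le> T"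
  shows "image_sum M T 0 y = 1"
proof -
  have M: "int y + 3 \<le> M" using assms by simp
  have "image_even M t 0 y = (if t = 0 then 1 else 0)" for t
  proof (cases "t = 0")
    case True
    have "qbin 1 y 0 = 1" by (induction y) (auto simp: qbin_eq_0)
    then show ?thesis using True by (simp add: image_even_def theta_def)
  next
    case False
    have "M \<le> M * t \<or> M * t \<le> - M"
      using False assms mult_left_mono [of 1 t M] mult_left_mono [of t "-1" M] by (cases "t > 0") auto
    then have "int 0 - M * t < 0 \<or> int 0 - M * t > int y"
      using M by linarith
    then show ?thesis using False by (simp add: image_even_def qbin_eq_0)
  qed
  moreover have "image_odd M t 0 y = 0" for t
  proof -
    have "M \<le> M * t \<or> M * t \<le> 0"
      using assms mult_left_mono [of 1 t M] mult_left_mono [of t 0 M] by (cases "t > 0") auto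
    then have "int 0 - 2 + M * t < 0 \<or> int 0 - 2 + M * t > int y"
      using M by linarith
    then show ?thesis by (simp add: image_odd_def qbin_eq_0)
  qed
  ultimately show ?thesis using assms by (simp add: image_sum_def)
qed

text \<open>Recurrence, edge conditions and the values at \<open>x = 0\<close> determine the solution on the strip and
  its two neighbouring diagonals.\<close>

theorem chain_gf_eq_image_sum:
  assumes "x \<le> y + 1" "y \<le> x + 2 * n + 1" "x + y < nat T"
  shows "chain_gf n x y = image_sum (2 * int n + 4) T x y"
  using assms
proof (induction "x + y" arbitrary: x y rule: less_induct)
  case less
  let ?H = "image_sum (2 * int n + 4) T"
  show ?case
  proof (cases "x = 0")
    case True
    then show ?thesis using less.prems by (simp add: chain_gf_0 image_sum_0)
  next
    case False
    then obtain x' where x: "x = Suc x'" by (cases x) auto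
    consider "x = y + 1" | "y = x + 2 * n + 1" | "x \<le> y" "y \<le> x + 2 * n"
      using less.prems by linarith
    then show ?thesis
    proof cases
      case 1
      have "chain_gf n y y = ?H y y" using less 1 by simp
      then show ?thesis using 1 by (simp add: chain_gf_diag image_sum_diag)
    next
      case 2
      have "chain_gf n x (x + 2 * n) = ?H x (x + 2 * n)" using less.prems 2 by (intro less.hyps) auto
      moreover have "?H x (x + 2 * n + 1) = ?H x (x + 2 * n)"
        using less.prems 2 by (intro image_sum_far) auto
      ultimately show ?thesis using chain_gf_far [of n x] 2 by simp
    next
      case 3
      then obtain y' where y: "y = Suc y'" using x by (cases y) auto
      have "(Suc x', Suc y') \<in> strip n" using 3 x y by (simp add: strip_def)
      moreover have "chain_gf n x' (Suc y') = ?H x' (Suc y')" "chain_gf n (Suc x') y' = ?H (Suc x') y'"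
        "chain_gf n x' y' = ?H x' y'"
        using less.prems 3 x y by (auto intro!: less.hyps)
      ultimately show ?thesis unfolding x y by (simp add: chain_gf_rec image_sum_rec)
    qed
  qed
qed

section \<open>Passing to the limit\<close>

lemma ord_ge_theta_term:
  assumes "1 \<le> w" "d \<le> e + w * (min k (int m - k) + 1)"
  shows "ord_ge d (qfac w m * (qpow e * qbin w m k) - qpow e)"
proof -
  have "ord_ge (e + w * (min k (int m - k) + 1)) (qpow e * (qbin w m k * qfac w m - 1))"
    by (intro ord_ge_mult ord_ge_qpow ord_ge_qbin_qfac assms)
  then have "ord_ge d (qpow e * (qbin w m k * qfac w m - 1))"
    by (rule ord_ge_mono) (rule assms)
  moreover have "qpow e * (qbin w m k * qfac w m - 1) = qfac w m * (qpow e * qbin w m k) - qpow e"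
    by (simp add: right_diff_distrib mult_ac)
  ultimately show ?thesis by simp
qed

lemma int_le_square: "t \<le> t * t" for t :: int
proof (cases "t \<le> 0")
  case True
  then show ?thesis using zero_le_square [of t] by linarith
next
  case False
  then show ?thesis using mult_left_mono [of 1 t t] by simp
qed

text \<open>The order of the binomial's deviation from its limit drops as the image moves away from the source, but
  only linearly, while the exponent of its weight grows quadratically; together they stay at least \<open>x\<close>.\<close>

lemma ord_ge_image_sum:
  assumes "4 \<le> M"
  shows "ord_ge (int x) (qfac 1 (x + x) * image_sum M T x x
     - (\<Sum>t\<in>{-T..T}. qpow (theta M 2 (- 2 * t)) - qpow (theta M 2 (1 - 2 * t))))"
proof -
  \<comment> \<open>Quadratic terms dominate linear ones over the integers because \<open>t\<close> and \<open>- t\<close> are at most \<open>t\<^sup>2\<close>.\<close>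
  have Msq: "4 * t \<le> 1 + M * (t * (t * 2))" for t
  proof -
    have "4 * (t * t) \<le> M * (t * t)" using assms by (intro mult_right_mono) auto
    then show ?thesis using int_le_square [of t] zero_le_square [of t] by linarith
  qed
  have sq: "4 * (t * t - t) \<le> M * (t * t - t)"
    "4 * (t * t + t) \<le> M * (t * t + t)" for t
    using assms int_le_square [of t] int_le_square [of "- t"]
      mult_right_mono [of 4 M "t * t - t"] mult_right_mono [of 4 M "t * t + t"]
    by simp_all
  have even: "ord_ge (int x) (qfac 1 (x + x) * image_even M t x x - qpow (theta M 2 (- 2 * t)))" for t
  proof -
    have "int x \<le> theta M 2 (- 2 * t) + 1 * (min (int x - M * t) (int (x + x) - (int x - M * t)) + 1)"
      unfolding theta_even using sq [of t] Msq [of t] int_le_square [of t] int_le_square [of "- t"]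
      by (simp add: min_def algebra_simps)
    then show ?thesis unfolding image_even_def by (intro ord_ge_theta_term) auto
  qed
  have odd: "ord_ge (int x) (qfac 1 (x + x) * image_odd M t x x - qpow (theta M 2 (1 - 2 * t)))" for t
  proof -
    have "int x \<le> theta M 2 (1 - 2 * t) + 1 * (min (int x - 2 + M * t) (int (x + x) - (int x - 2 + M * t)) + 1)"
      unfolding theta_odd using sq [of t] Msq [of t] int_le_square [of t] zero_le_square [of "t - 1"]
      by (simp add: min_def algebra_simps)
    then show ?thesis unfolding image_odd_def by (intro ord_ge_theta_term) auto
  qed
  have "qfac 1 (x + x) * image_sum M T x x
     - (\<Sum>t\<in>{-T..T}. qpow (theta M 2 (- 2 * t)) - qpow (theta M 2 (1 - 2 * t)))
     = (\<Sum>t\<in>{-T..T}. (qfac 1 (x + x) * image_even M t x x - qpow (theta M 2 (- 2 * t)))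
         - (qfac 1 (x + x) * image_odd M t x x - qpow (theta M 2 (1 - 2 * t))))"
    unfolding image_sum_def by (simp add: sum_distrib_left sum_subtractf right_diff_distrib)
  then show ?thesis
    by (simp only:) (intro ord_ge_sum ord_ge_diff even odd)
qed

text \<open>The same trade-off between binomial and weight as in \<open>ord_ge_image_sum\<close>, for the triple product.\<close>

lemma ord_ge_theta_sum:
  assumes "0 \<le> a" "a \<le> w" "1 \<le> w"
  shows "ord_ge (w * int L) (qfac w (2 * L) * theta_sum w a lo hi (2 * L) (int L)
     - (\<Sum>j\<in>{lo..hi}. alt j * qpow (theta w a j)))"
proof -
  have *: "ord_ge (w * int L) (qfac w (2 * L) * (qpow (theta w a j) * qbin w (2 * L) (int L + j)) - qpow (theta w a j))" for j
  proof -
    define c where "c = j * (j - 1) div 2"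
    have c: "2 * c = j * (j - 1)" by (simp add: c_def)
    have th: "theta w a j = w * c + a * j" by (simp add: theta_def c_def)
    have "w * int L \<le> theta w a j + w * (min (int L + j) (int (2 * L) - (int L + j)) + 1)"
    proof (cases "j \<ge> 0")
      case True
      \<comment> \<open>No integer lies strictly between \<open>1\<close> and \<open>2\<close>.\<close>
      have "0 \<le> (j - 1) * (j - 2)"
        by (cases "j \<ge> 2"; cases "j = 1") (auto simp: zero_le_mult_iff)
      then have "0 \<le> c - j + 1" using c by (simp add: algebra_simps)
      then have "0 \<le> w * (c - j + 1)" "0 \<le> a * j" using assms True by auto
      then show ?thesis using True by (auto simp: th min_def algebra_simps)
    next
      case False
      have "0 \<le> (j + 1) * (j + 2)"
        by (cases "j \<le> - 2"; cases "j = - 1") (auto simp: zero_le_mult_iff)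
      then have "0 \<le> c + j + j + 1" using c by (simp add: algebra_simps)
      then have "0 \<le> w * (c + j + j + 1)" using assms by auto
      moreover have "w * j \<le> a * j" using assms False by (simp add: mult_right_mono_neg)
      ultimately have "0 \<le> w + a * j + w * c + w * j" unfolding distrib_left by linarith
      then show ?thesis using False by (simp add: th min_def algebra_simps)
    qed
    then show ?thesis using assms by (intro ord_ge_theta_term) auto
  qed
  have "qfac w (2 * L) * theta_sum w a lo hi (2 * L) (int L) - (\<Sum>j\<in>{lo..hi}. alt j * qpow (theta w a j))
     = (\<Sum>j\<in>{lo..hi}. alt j * (qfac w (2 * L) * (qpow (theta w a j) * qbin w (2 * L) (int L + j)) - qpow (theta w a j)))"
    unfolding theta_sum_def by (simp add: sum_distrib_left sum_subtractf algebra_simps)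
  moreover have "ord_ge 0 (alt j)" for j
    by (auto simp: alt_def intro: ord_ge_1 ord_ge_uminus)
  ultimately show ?thesis
    by (simp only:) (intro ord_ge_sum ord_ge_mult_left *)
qed

lemma sum_even_odd:
  "(\<Sum>j\<in>{- 2 * T..2 * T + 1}. g j) = (\<Sum>t\<in>{-T..T}. g (- 2 * t) + g (1 - 2 * t))"
  for g :: "int \<Rightarrow> 'a::comm_monoid_add"
proof -
  let ?E = "(\<lambda>t. - 2 * t) ` {-T..T}" and ?O = "(\<lambda>t. 1 - 2 * t) ` {-T..T}"
  have "j \<in> ?E \<union> ?O" if "j \<in> {- 2 * T..2 * T + 1}" for j
  proof (cases "even j")
    case True
    then have "j = - 2 * (- (j div 2))" "- (j div 2) \<in> {-T..T}" using that by auto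
    then show ?thesis by blast
  next
    case False
    then have "j = 1 - 2 * (- (j div 2))" by presburger
    moreover have "- (j div 2) \<in> {-T..T}" using that by auto
    ultimately show ?thesis by blast
  qed
  then have "{- 2 * T..2 * T + 1} \<subseteq> ?E \<union> ?O" by blast
  moreover have "?E \<union> ?O \<subseteq> {- 2 * T..2 * T + 1}" by auto
  ultimately have "{- 2 * T..2 * T + 1} = ?E \<union> ?O" by (rule equalityI)
  moreover have "?E \<inter> ?O = {}"
  proof -
    have "- 2 * s \<noteq> 1 - 2 * t" for s t :: int by presburger
    then show ?thesis by blast
  qed
  ultimately have "(\<Sum>j\<in>{- 2 * T..2 * T + 1}. g j) = sum g ?E + sum g ?O"
    by (simp add: sum.union_disjoint)
  also have "sum g ?E = (\<Sum>t\<in>{-T..T}. g (- 2 * t))"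
    by (subst sum.reindex) (auto simp: inj_on_def)
  also have "sum g ?O = (\<Sum>t\<in>{-T..T}. g (1 - 2 * t))"
    by (subst sum.reindex) (auto simp: inj_on_def)
  finally show ?thesis by (simp add: sum.distrib)
qed

section \<open>Partitions with parts from a finite set\<close>

definition partitions_from :: "nat set \<Rightarrow> nat \<Rightarrow> nat multiset set" where
  "partitions_from S N = {p. set_mset p \<subseteq> S \<and> \<Sum>\<^sub># p = N}"

text \<open>Remove one part \<open>m\<close>, if there is one.\<close>

lemma partitions_from_insert:
  assumes "m \<notin> S"
  shows "partitions_from (insert m S) N = partitions_from S N \<union>
     (if m \<le> N then add_mset m ` partitions_from (insert m S) (N - m) else {})"
proof -
  have "p \<in> partitions_from S N \<union>
     (if m \<le> N then add_mset m ` partitions_from (insert m S) (N - m) else {})"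
    if p: "p \<in> partitions_from (insert m S) N" for p
  proof (cases "m \<in># p")
    case True
    then obtain q where q: "p = add_mset m q" by (metis multi_member_split)
    then have "m \<le> N" "q \<in> partitions_from (insert m S) (N - m)"
      using p by (auto simp: partitions_from_def)
    then show ?thesis using q by simp
  next
    case False
    then show ?thesis using p by (auto simp: partitions_from_def)
  qed
  moreover have "partitions_from S N \<union>
     (if m \<le> N then add_mset m ` partitions_from (insert m S) (N - m) else {})
     \<subseteq> partitions_from (insert m S) N"
    by (auto simp: partitions_from_def)
  ultimately show ?thesis by blast
qed

lemma finite_partitions_from:
  assumes "finite S" "0 \<notin> S"
  shows "finite (partitions_from S N)"
proof (induction N rule: less_induct)
  case (less N)
  have "partitions_from S N \<subseteq> insert {#} (\<Union>m\<in>S \<inter> {..N}. add_mset m ` partitions_from S (N - m))"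
  proof
    fix p assume p: "p \<in> partitions_from S N"
    show "p \<in> insert {#} (\<Union>m\<in>S \<inter> {..N}. add_mset m ` partitions_from S (N - m))"
    proof (cases p)
      case (add m q)
      then have "m \<in> S \<inter> {..N}" "q \<in> partitions_from S (N - m)"
        using p by (auto simp: partitions_from_def)
      then show ?thesis using add by blast
    qed simp
  qed
  moreover have "finite (partitions_from S (N - m))" if "m \<in> S \<inter> {..N}" for m
    using that assms by (intro less) (auto intro!: diff_less Nat.gr0I)
  ultimately show ?case
    using assms by (elim finite_subset) auto
qed

definition partitions_gf :: "nat set \<Rightarrow> int fls" where
  "partitions_gf S = fps_to_fls (Abs_fps (\<lambda>N. int (card (partitions_from S N))))"

lemma nth_partitions_gf:
  "fls_nth (partitions_gf S) i = (if i < 0 then 0 else int (card (partitions_from S (nat i))))"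
  by (simp add: partitions_gf_def)

lemma ord_ge_partitions_gf: "ord_ge 0 (partitions_gf S)"
  by (simp add: ord_ge_def nth_partitions_gf)

lemma partitions_gf_insert:
  assumes "finite S" "m \<notin> S" "0 < m" "0 \<notin> S"
  shows "(1 - qpow (int m)) * partitions_gf (insert m S) = partitions_gf S"
proof (rule fls_eqI)
  fix i :: int
  have card: "card (partitions_from (insert m S) N) = card (partitions_from S N)
      + (if m \<le> N then card (partitions_from (insert m S) (N - m)) else 0)" for N
  proof -
    have "partitions_from S N \<inter> add_mset m ` A = {}" for A
      using assms by (auto simp: partitions_from_def)
    moreover have "finite (partitions_from T K)" if "T = S \<or> T = insert m S" for T K
      using that assms by (auto intro!: finite_partitions_from)
    ultimately show ?thesis
      using partitions_from_insert [OF assms(2), of N] by (auto simp: card_Un_disjoint card_image inj_on_def)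
  qed
  show "fls_nth ((1 - qpow (int m)) * partitions_gf (insert m S)) i = fls_nth (partitions_gf S) i"
  proof (cases "i < 0")
    case False
    then have "nat (i - int m) = nat i - m" "i < int m \<longleftrightarrow> \<not> m \<le> nat i" by auto
    then show ?thesis using False card [of "nat i"]
      by (simp add: left_diff_distrib nth_qpow_mult nth_partitions_gf)
  qed (simp add: left_diff_distrib nth_qpow_mult nth_partitions_gf)
qed

lemma partitions_gf_prod:
  assumes "finite S" "0 \<notin> S"
  shows "(\<Prod>m\<in>S. 1 - qpow (int m)) * partitions_gf S = 1"
  using assms
proof (induction S rule: finite_induct)
  case empty
  have "partitions_from {} N = (if N = 0 then {{#}} else {})" for N
    by (auto simp: partitions_from_def)
  then show ?case by (intro fls_eqI) (auto simp: nth_partitions_gf)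
next
  case (insert m S)
  have "(\<Prod>m\<in>insert m S. 1 - qpow (int m)) * partitions_gf (insert m S)
      = (\<Prod>m\<in>S. 1 - qpow (int m)) * ((1 - qpow (int m)) * partitions_gf (insert m S))"
    using insert by (simp add: mult_ac)
  also have "\<dots> = 1" using insert by (simp add: partitions_gf_insert)
  finally show ?case .
qed

section \<open>The product formula for chains\<close>

definition chains_of :: "nat \<Rightarrow> nat \<Rightarrow> (nat \<times> nat) set set" where
  "chains_of n N = {C. finite C \<and> C \<subseteq> strip n \<and> pairwise comparable C \<and> (\<Sum>u\<in>C. hook u) = N}"

text \<open>A point of a chain of weight \<open>N\<close> has both coordinates at most \<open>N\<close>, so the square loses nothing.\<close>

lemma nth_chain_gf:
  assumes "N \<le> x"
  shows "fls_nth (chain_gf n x x) (int N) = int (card (chains_of n N))"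
proof -
  have eq: "{C \<in> chains n x x. N = (\<Sum>u\<in>C. hook u)} = chains_of n N"
  proof (intro equalityI subsetI)
    fix C assume C: "C \<in> chains_of n N"
    have "u \<in> {..x} \<times> {..x}" if u: "u \<in> C" for u
    proof -
      have "hook u \<le> (\<Sum>u\<in>C. hook u)"
        using C u by (intro member_le_sum) (auto simp: chains_of_def)
      moreover have "u \<in> strip n" using C u by (auto simp: chains_of_def)
      ultimately show ?thesis using C assms by (cases u) (auto simp: chains_of_def hook_def strip_def)
    qed
    then show "C \<in> {C \<in> chains n x x. N = (\<Sum>u\<in>C. hook u)}"
      using C by (auto simp: chains_of_def chains_def)
  qed (auto simp: chains_of_def finite_chain, auto simp: chains_def)
  have "fls_nth (chain_gf n x x) (int N)
      = (\<Sum>C\<in>chains n x x. if N = (\<Sum>u\<in>C. hook u) then 1 else 0)"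
    unfolding chain_gf_def fls_nth_sum nth_qpow by (intro sum.cong refl) (simp only: of_nat_eq_iff)
  also have "\<dots> = int (card {C \<in> chains n x x. N = (\<Sum>u\<in>C. hook u)})"
    by (subst sum.inter_filter [symmetric]) (simp_all add: finite_chains)
  finally show ?thesis unfolding eq .
qed

definition special_residue :: "nat \<Rightarrow> nat \<Rightarrow> bool" where
  "special_residue M m \<longleftrightarrow> m mod M = 0 \<or> m mod M = 2 \<or> m mod M = M - 2"

lemma special_residues:
  assumes "4 < M"
  shows "{m \<in> {1..M * L}. special_residue M m}
       = (\<lambda>k. M * k) ` {1..L} \<union> (\<lambda>k. 2 + M * k) ` {0..<L} \<union> (\<lambda>k. M * k - 2) ` {1..L}"
    (is "?L = ?R")
proof (intro equalityI subsetI)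
  fix m assume m: "m \<in> ?L"
  define k where "k = m div M"
  have mk: "m = M * k + m mod M" by (simp add: k_def)
  have "M * k \<le> m" by (simp add: k_def)
  also have "m \<le> M * L" using m by simp
  finally have "M * k \<le> M * L" .
  then have kL: "k \<le> L" using assms by simp
  have less: "k < L" if "m mod M \<noteq> 0"
  proof (rule ccontr)
    assume "\<not> k < L"
    then show False using kL that mk m by auto
  qed
  from m consider "m mod M = 0" | "m mod M = 2" | "m mod M = M - 2" by (auto simp: special_residue_def)
  then show "m \<in> ?R"
  proof cases
    case 1
    then have "m = M * k" "k \<in> {1..L}" using mk kL m by (auto simp: Suc_le_eq intro!: Nat.gr0I)
    then show ?thesis by blast
  next
    case 2
    then have "m = 2 + M * k" "k \<in> {0..<L}" using mk less by auto
    then show ?thesis by blast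
  next
    case 3
    then have "m = M * Suc k - 2" "Suc k \<in> {1..L}" using mk less assms by auto
    then show ?thesis by blast
  qed
next
  fix m assume "m \<in> ?R"
  then consider k where "m = M * k" "k \<in> {1..L}" | k where "m = 2 + M * k" "k < L"
    | k where "m = M - 2 + M * k" "k < L"
  proof (elim UnE imageE)
    fix k assume "m = M * k - 2" "k \<in> {1..L}"
    then have "m = M - 2 + M * (k - 1)" "k - 1 < L" using assms by (cases k; auto)+
    then show ?thesis using that(3) by blast
  qed (use that in auto)
  then show "m \<in> ?L"
  proof cases
    case 1
    then show ?thesis using assms by (auto simp: special_residue_def)
  next
    case 2
    have "M * Suc k \<le> M * L" using 2 by (intro mult_left_mono) auto
    moreover have "(2 + M * k) mod M = 2 mod M" by (simp only: mod_mult_self2)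
    ultimately show ?thesis using 2 assms by (auto simp: special_residue_def)
  next
    case 3
    have "M * Suc k \<le> M * L" using 3 by (intro mult_left_mono) auto
    moreover have "(M - 2 + M * k) mod M = (M - 2) mod M" by (simp only: mod_mult_self2)
    ultimately show ?thesis using 3 assms by (auto simp: special_residue_def)
  qed
qed

text \<open>The three families of factors on the right are those of the triple product in base \<open>q\<^sup>M\<close> at \<open>q\<^sup>2\<close>.\<close>

lemma prod_special_residues:
  assumes "4 < M"
  shows "(\<Prod>m\<in>{m \<in> {1..M * L}. special_residue M m}. 1 - qpow (int m))
       = qfac (int M) L * ((\<Prod>k\<in>{0..<L}. 1 - qpow (2 + int M * int k))
           * (\<Prod>k\<in>{1..L}. 1 - qpow (int M * int k - 2)))"
proof -
  let ?A = "(\<lambda>k. M * k) ` {1..L}" and ?B = "(\<lambda>k. 2 + M * k) ` {0..<L}"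
    and ?C = "(\<lambda>k. M * k - 2) ` {1..L}"
  have A: "m mod M = 0" if "m \<in> ?A" for m using that by auto
  have B: "m mod M = 2" if "m \<in> ?B" for m
  proof -
    from that obtain k where "m = 2 + M * k" by auto
    then have "m mod M = 2 mod M" by (simp only: mod_mult_self2)
    then show ?thesis using assms by simp
  qed
  have C: "m mod M = M - 2" if "m \<in> ?C" for m
  proof -
    from that obtain k where "m = M * k - 2" "k \<ge> 1" by auto
    then have "m = (M - 2) + M * (k - 1)" using assms by (cases k) auto
    then have "m mod M = (M - 2) mod M" by (simp only: mod_mult_self2)
    then show ?thesis using assms by simp
  qed
  have "?A \<inter> ?B = {}" using A B by fastforce
  moreover have "(?A \<union> ?B) \<inter> ?C = {}" using A B C assms by fastforce
  ultimately have "(\<Prod>m\<in>{m \<in> {1..M * L}. special_residue M m}. 1 - qpow (int m))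
      = (\<Prod>m\<in>?A. 1 - qpow (int m)) * (\<Prod>m\<in>?B. 1 - qpow (int m)) * (\<Prod>m\<in>?C. 1 - qpow (int m))"
    unfolding special_residues [OF assms] by (simp add: prod.union_disjoint)
  also have "(\<Prod>m\<in>?A. 1 - qpow (int m)) = qfac (int M) L"
    unfolding qfac_def using assms by (subst prod.reindex) (auto simp: inj_on_def)
  also have "(\<Prod>m\<in>?B. 1 - qpow (int m)) = (\<Prod>k\<in>{0..<L}. 1 - qpow (2 + int M * int k))"
    using assms by (subst prod.reindex) (auto simp: inj_on_def)
  also have "(\<Prod>m\<in>?C. 1 - qpow (int m)) = (\<Prod>k\<in>{1..L}. 1 - qpow (int M * int k - 2))"
  proof (subst prod.reindex)
    have ge: "2 \<le> M * k" if "k \<in> {1..L}" for k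
      using that assms mult_le_mono [of 2 M 1 k] by simp
    show "inj_on (\<lambda>k. M * k - 2) {1..L}"
      using ge assms by (auto intro!: inj_onI dest!: eq_diff_iff [THEN iffD1, rotated 2])
    show "prod ((\<lambda>m. 1 - qpow (int m)) \<circ> (\<lambda>k. M * k - 2)) {1..L}
        = (\<Prod>k\<in>{1..L}. 1 - qpow (int M * int k - 2))"
      using ge by (intro prod.cong refl) (simp add: of_nat_diff)
  qed
  finally show ?thesis by (simp add: mult.assoc)
qed

lemma congruence_partitions_eq:
  assumes "N \<le> (2 * n + 4) * L"
  shows "congruence_partitions n N
       = partitions_from {m \<in> {1..(2 * n + 4) * L}. \<not> special_residue (2 * n + 4) m} N"
proof -
  let ?M = "2 * n + 4"
  have "[int m = 0] (mod int ?M) \<longleftrightarrow> m mod ?M = 0" for m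
    using cong_int_iff [of m 0 ?M] by (simp add: cong_def)
  moreover have "[int m = 2] (mod int ?M) \<longleftrightarrow> m mod ?M = 2" for m
    using cong_int_iff [of m 2 ?M] by (simp add: cong_def)
  moreover have "[int m = - 2] (mod int ?M) \<longleftrightarrow> m mod ?M = ?M - 2" for m
  proof -
    have "int (?M - 2) = - 2 + int ?M" by simp
    then have "[- 2 = int (?M - 2)] (mod int ?M)" by (simp only: cong_def mod_add_self2)
    then have "[int m = - 2] (mod int ?M) \<longleftrightarrow> [int m = int (?M - 2)] (mod int ?M)"
      by (meson cong_sym cong_trans)
    then show ?thesis using cong_int_iff [of m "?M - 2" ?M] by (simp add: cong_def)
  qed
  ultimately have res: "[int m = 0] (mod int ?M) \<or> [int m = 2] (mod int ?M) \<or> [int m = - 2] (mod int ?M)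
      \<longleftrightarrow> special_residue ?M m" for m
    by (simp add: special_residue_def)
  have le: "m \<le> ?M * L" if "m \<in># p" "\<Sum>\<^sub># p = N" for m p
    using that assms by (metis le_add1 le_trans sum_mset.remove)
  show ?thesis
  proof (intro equalityI subsetI)
    fix p assume p: "p \<in> congruence_partitions n N"
    have "1 \<le> m \<and> m \<le> ?M * L \<and> \<not> special_residue ?M m" if m: "m \<in># p" for m
    proof (intro conjI)
      show "1 \<le> m" "m \<le> ?M * L" using p m le by (auto simp: congruence_partitions_def)
      then show "\<not> special_residue ?M m"
        using p m unfolding congruence_partitions_def res not_in_iff [symmetric] by blast
    qed
    then show "p \<in> partitions_from {m \<in> {1..?M * L}. \<not> special_residue ?M m} N"
      using p by (auto simp: partitions_from_def congruence_partitions_def)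
  next
    fix p assume p: "p \<in> partitions_from {m \<in> {1..?M * L}. \<not> special_residue ?M m} N"
    then have "count p m = 0" if "special_residue ?M m" for m
      using that by (auto simp: partitions_from_def not_in_iff [symmetric])
    then show "p \<in> congruence_partitions n N"
      using p unfolding congruence_partitions_def res by (auto simp: partitions_from_def)
  qed
qed

text \<open>The theta series is the meeting point: it is congruent to \<open>(q; q)\<close> times the generating function of the
  chains by the limit of the images, and to the product over the special residues by the triple
  product.\<close>

theorem card_chains_of:
  assumes "1 \<le> n"
  shows "card (chains_of n N) = card (congruence_partitions n N)"
proof -
  define M where "M = 2 * n + 4"
  \<comment> \<open>The square has side \<open>x\<close> with \<open>2 x = M L\<close>, so that \<open>(q; q)\<close> truncated at \<open>2 x\<close> has exponents
    running \<open>L\<close> times through all residues modulo \<open>M\<close>.\<close>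
  define L where "L = Suc N"
  define x where "x = (n + 2) * L"
  define T where "T = int (x + x + 1)"
  define d where "d = int N + 1"
  let ?S = "\<Sum>j\<in>{- 2 * T..2 * T + 1}. alt j * qpow (theta (int M) 2 j)"
  let ?all = "{1..M * L}"
  let ?bad = "{m \<in> ?all. special_residue M m}" and ?good = "{m \<in> ?all. \<not> special_residue M m}"
  let ?P = "\<lambda>A. \<Prod>m\<in>A. 1 - qpow (int m)"
  let ?U = "(\<Prod>k\<in>{0..<L}. 1 - qpow (2 + int M * int k)) * (\<Prod>k\<in>{1..L}. 1 - qpow (int M * int k - 2))"
  have xx: "x + x = M * L" by (simp add: x_def M_def algebra_simps)
  have "d = int L" by (simp add: d_def L_def)
  moreover have Lx: "L \<le> x" by (simp add: x_def)
  moreover have "1 * int L \<le> int M * int L" by (intro mult_right_mono) (simp_all add: M_def)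
  ultimately have Nx: "d \<le> int x" "d \<le> int M * int L"
    by (simp_all only: mult_1_left of_nat_le_iff)
  have LT: "int L < 2 * T" using Lx by (simp add: T_def)

  have "ord_ge (int x) (qfac 1 (x + x) * image_sum (int M) T x x
      - (\<Sum>t\<in>{-T..T}. qpow (theta (int M) 2 (- 2 * t)) - qpow (theta (int M) 2 (1 - 2 * t))))"
    by (rule ord_ge_image_sum) (simp add: M_def)
  also have "(\<Sum>t\<in>{-T..T}. qpow (theta (int M) 2 (- 2 * t)) - qpow (theta (int M) 2 (1 - 2 * t))) = ?S"
    unfolding sum_even_odd [where T = T] by (simp add: alt_def)
  finally have 1: "ord_ge d (qfac 1 (x + x) * image_sum (int M) T x x - ?S)"
    by (rule ord_ge_mono) (rule Nx)
  have "theta_sum (int M) 2 (- 2 * T) (2 * T + 1) (2 * L) (int L) = ?U"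
    using LT by (intro finite_triple_product) auto
  then have "ord_ge (int M * int L) (qfac (int M) (2 * L) * ?U - ?S)"
    using ord_ge_theta_sum [of 2 "int M" L "- 2 * T" "2 * T + 1"] by (simp add: M_def)
  then have 2: "ord_ge d (qfac (int M) (2 * L) * ?U - ?S)"
    by (rule ord_ge_mono) (rule Nx)
  have 3: "ord_ge d (qfac (int M) (2 * L) * ?U - qfac (int M) L * ?U)"
  proof -
    have "ord_ge d ((\<Prod>j\<in>{L+1..2*L}. 1 - qpow (int M * int j)) - 1)"
    proof (rule ord_ge_prod_one_minus)
      fix j assume "j \<in> {L+1..2*L}"
      then have "int M * int L \<le> int M * int j" by (intro mult_left_mono) auto
      then show "d \<le> int M * int j" using Nx by simp
    qed (simp add: d_def)
    moreover have "ord_ge 0 (qfac (int M) L * ?U)"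
      unfolding qfac_def
    proof (intro ord_ge_mult_left ord_ge_prod_0 ord_ge_one_minus_qpow)
      fix k assume "k \<in> {1..L}"
      then have "int M * 1 \<le> int M * int k" by (intro mult_left_mono) auto
      moreover have "2 \<le> int M" by (simp add: M_def)
      ultimately show "0 \<le> int M * int k - 2" by linarith
    qed auto
    ultimately have "ord_ge d ((qfac (int M) L * ?U) * ((\<Prod>j\<in>{L+1..2*L}. 1 - qpow (int M * int j)) - 1))"
      by (rule ord_ge_mult_left [rotated])
    moreover have "qfac (int M) (2 * L) = qfac (int M) L * (\<Prod>j\<in>{L+1..2*L}. 1 - qpow (int M * int j))"
      by (rule qfac_split) simp
    ultimately show ?thesis by (simp only: right_diff_distrib mult_1_right mult_1_left mult_ac)
  qed
  \<comment> \<open>Modulo \<open>q\<^sup>d\<close>, both sides are the theta series.\<close>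
  have "ord_ge d (qfac 1 (x + x) * image_sum (int M) T x x - qfac (int M) L * ?U)"
    using ord_ge_diff [OF ord_ge_add [OF 1 3] 2] by simp
  moreover have "image_sum (int M) T x x = chain_gf n x x"
    using chain_gf_eq_image_sum [of x x n T] by (simp add: M_def T_def)
  moreover have "qfac 1 (x + x) = ?P ?all"
    by (simp add: qfac_def xx)
  moreover have "qfac (int M) L * ?U = ?P ?bad"
    using assms by (intro prod_special_residues [symmetric]) (simp add: M_def)
  ultimately have "ord_ge d (?P ?all * chain_gf n x x - ?P ?bad)" by simp
  \<comment> \<open>Dividing by the product over all parts leaves the partitions into good parts.\<close>
  then have "ord_ge d (partitions_gf ?all * (?P ?all * chain_gf n x x - ?P ?bad))"
    by (intro ord_ge_mult_left ord_ge_partitions_gf)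
  also have "partitions_gf ?all * (?P ?all * chain_gf n x x - ?P ?bad) = chain_gf n x x - partitions_gf ?good"
  proof -
    have all: "?P ?all * partitions_gf ?all = 1" by (rule partitions_gf_prod) auto
    have good: "?P ?good * partitions_gf ?good = 1" by (rule partitions_gf_prod) auto
    have "?all = ?good \<union> ?bad" by auto
    then have "?P ?all = ?P (?good \<union> ?bad)" by (rule prod.cong) (rule refl)
    also have "\<dots> = ?P ?good * ?P ?bad" by (intro prod.union_disjoint) auto
    finally have split: "?P ?all = ?P ?good * ?P ?bad" .
    have "partitions_gf ?good = partitions_gf ?good * (?P ?all * partitions_gf ?all)"
      by (simp only: all mult_1_right)
    also have "\<dots> = (?P ?good * partitions_gf ?good) * (?P ?bad * partitions_gf ?all)"
      unfolding split by (simp only: mult_ac)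
    also have "\<dots> = ?P ?bad * partitions_gf ?all" by (simp only: good mult_1_left)
    finally have "partitions_gf ?good = ?P ?bad * partitions_gf ?all" .
    moreover have "partitions_gf ?all * (?P ?all * chain_gf n x x - ?P ?bad)
        = (?P ?all * partitions_gf ?all) * chain_gf n x x - ?P ?bad * partitions_gf ?all"
      by (simp only: right_diff_distrib mult_ac)
    ultimately show ?thesis by (simp only: all mult_1_left)
  qed
  finally have "fls_nth (chain_gf n x x) (int N) = fls_nth (partitions_gf ?good) (int N)"
    by (simp add: ord_ge_def d_def)
  moreover have "N \<le> x" using Nx by (simp add: d_def)
  moreover from this have "N \<le> M * L" using xx by linarith
  ultimately have "card (chains_of n N) = card (partitions_from ?good N)"
    by (simp add: nth_chain_gf nth_partitions_gf)
  also have "partitions_from ?good N = congruence_partitions n N"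
    using \<open>N \<le> M * L\<close> unfolding M_def by (rule congruence_partitions_eq [symmetric])
  finally show ?thesis .
qed

section \<open>Gluing the triangles to a strip\<close>

definition triples :: "nat \<Rightarrow> (nat \<times> nat \<times> nat) set" where
  "triples n = {(a, b, j). tri_index n a b \<and> j \<ge> 1}"

text \<open>Odd triangles are translated along the diagonal; even ones are first reflected, which puts their
  row index on the horizontal axis, next to the columns of the preceding triangle.\<close>

definition strip_point :: "nat \<Rightarrow> nat \<times> nat \<times> nat \<Rightarrow> nat \<times> nat" where
  "strip_point n = (\<lambda>(a, b, j). let s = 2 * n * ((j - 1) div 2) in
     if odd j then (a + s, b + s) else (b + s, a + s + 2 * n))"

lemma strip_point_odd: "strip_point n (a, b, 2 * i + 1) = (a + 2 * n * i, b + 2 * n * i)"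
  by (simp add: strip_point_def Let_def)

lemma strip_point_even:
  "strip_point n (a, b, 2 * i + 2) = (b + 2 * n * i, a + 2 * n * i + 2 * n)"
  by (simp add: strip_point_def Let_def)

lemma odd_even_index_cases:
  fixes j :: nat
  assumes "1 \<le> j"
  obtains i where "j = 2 * i + 1" | i where "j = 2 * i + 2"
proof (cases "odd j")
  case True
  then show ?thesis using that(1) by (auto elim: oddE)
next
  case False
  then have "j = 2 * (j div 2 - 1) + 2" using assms by auto
  then show ?thesis using that(2) by blast
qed

lemma comparable_commute: "comparable u v \<longleftrightarrow> comparable v u"
  by (auto simp: comparable_def)

lemma comparable_same_triangle:
  assumes "1 \<le> j"
  shows "comparable (strip_point n (a, b, j)) (strip_point n (a', b', j))
     \<longleftrightarrow> a < a' \<and> b < b' \<or> a' < a \<and> b' < b"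
  using assms
  by (cases rule: odd_even_index_cases)
     (auto simp: comparable_def strip_point_odd [simplified] strip_point_even [simplified])

text \<open>Consecutive triangles share the rows or the columns of the strip, so one of the two coordinates is
  always ordered correctly and the other one compares \<open>b\<close> with \<open>a'\<close>.\<close>

lemma comparable_next_triangle:
  assumes "1 \<le> j" "tri_index n a b" "tri_index n a' b'"
  shows "comparable (strip_point n (a, b, j + 1)) (strip_point n (a', b', j)) \<longleftrightarrow> a' < b"
  using assms(1)
proof (cases rule: odd_even_index_cases)
  case (1 i)
  then have "j + 1 = 2 * i + 2" by simp
  then show ?thesis
    using assms(2,3) unfolding 1 by (simp only: strip_point_even strip_point_odd) (auto simp: comparable_def tri_index_def)
next
  case (2 i)
  then have "j + 1 = 2 * (i + 1) + 1" by simp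
  then show ?thesis
    using assms(2,3) unfolding 2 by (simp only: strip_point_even strip_point_odd) (auto simp: comparable_def tri_index_def)
qed

lemma comparable_far_triangle:
  assumes "1 \<le> j" "j + 2 \<le> j'" "tri_index n a b" "tri_index n a' b'"
  shows "comparable (strip_point n (a, b, j)) (strip_point n (a', b', j'))"
proof -
  have far: "2 * n * i + 2 * n \<le> 2 * n * i'" if "i < i'" for i i'
    using mult_le_mono2 [of "Suc i" i' "2 * n"] that by simp
  have "1 \<le> j'" using assms by simp
  then show ?thesis
  proof (cases rule: odd_even_index_cases)
    case j': (1 i')
    from assms(1) show ?thesis
    proof (cases rule: odd_even_index_cases)
      case (1 i)
      then show ?thesis using assms far [of i i'] unfolding 1 j' strip_point_odd
        by (auto simp: comparable_def tri_index_def)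
    next
      case (2 i)
      then have "2 * n * i + 2 * n + 2 * n \<le> 2 * n * i'"
        using far [of i "i + 1"] far [of "i + 1" i'] assms j' by simp
      then show ?thesis using assms unfolding 2 j' strip_point_odd strip_point_even
        by (auto simp: comparable_def tri_index_def)
    qed
  next
    case j': (2 i')
    from assms(1) show ?thesis
    proof (cases rule: odd_even_index_cases)
      case (1 i)
      then show ?thesis using assms far [of i i'] unfolding 1 j' strip_point_odd strip_point_even
        by (auto simp: comparable_def tri_index_def)
    next
      case (2 i)
      then show ?thesis using assms far [of i i'] unfolding 2 j' strip_point_even
        by (auto simp: comparable_def tri_index_def)
    qed
  qed
qed

text \<open>Injectivity comes from comparability: a point is not comparable with itself, so two triples with
  the same point lie in the same triangle or in neighbouring ones.\<close>

lemma bij_betw_strip_point: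
  assumes "1 \<le> n"
  shows "bij_betw (strip_point n) (triples n) (strip n)"
proof (rule bij_betw_imageI)
  have *: "t = t'" if "t \<in> triples n" "t' \<in> triples n" "strip_point n t = strip_point n t'"
    "snd (snd t) \<le> snd (snd t')" for t t'
  proof -
    obtain a b j a' b' j' where t: "t = (a, b, j)" "t' = (a', b', j')" by (cases t, cases t') auto
    have idx: "tri_index n a b" "tri_index n a' b'" "1 \<le> j" "j \<le> j'"
      using that by (auto simp: t triples_def)
    have eq: "strip_point n (a, b, j) = strip_point n (a', b', j')" using that t by simp
    then have nc: "\<not> comparable (strip_point n (a, b, j)) (strip_point n (a', b', j'))"
      by (simp add: comparable_def)
    then have "\<not> j + 2 \<le> j'" using comparable_far_triangle idx by blast
    moreover have "j' \<noteq> j + 1"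
    proof
      assume j': "j' = j + 1"
      from idx(3) show False
      proof (cases rule: odd_even_index_cases)
        case (1 i)
        then have "j' = 2 * i + 2" using j' by simp
        then show False
          using eq idx(1,2) unfolding 1 by (simp only: strip_point_even strip_point_odd) (auto simp: tri_index_def)
      next
        case (2 i)
        then have "j' = 2 * (i + 1) + 1" using j' by simp
        then show False
          using eq idx(1,2) unfolding 2 by (simp only: strip_point_even strip_point_odd) (auto simp: tri_index_def)
      qed
    qed
    ultimately have j': "j' = j" using idx by simp
    from idx(3) eq show ?thesis unfolding j' t
      by (cases rule: odd_even_index_cases) (auto simp: strip_point_odd [simplified] strip_point_even [simplified])
  qed
  show "inj_on (strip_point n) (triples n)"
    by (rule inj_onI) (metis * nle_le)
  show "strip_point n ` triples n = strip n"
  proof (intro equalityI subsetI)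
    fix u assume "u \<in> strip_point n ` triples n"
    then obtain a b j where u: "u = strip_point n (a, b, j)" "tri_index n a b" "1 \<le> j"
      by (auto simp: triples_def)
    from u(3) u(1,2) show "u \<in> strip n"
      by (cases rule: odd_even_index_cases)
         (auto simp: strip_point_odd [simplified] strip_point_even [simplified] strip_def tri_index_def)
  next
    fix u assume "u \<in> strip n"
    then obtain x y where u: "u = (x, y)" "1 \<le> x" "x \<le> y" "y \<le> x + 2 * n" by (auto simp: strip_def)
    define i where "i = (x - 1) div (2 * n)"
    define a where "a = (x - 1) mod (2 * n) + 1"
    have x: "x = a + 2 * n * i" using u by (simp add: a_def i_def)
    have a: "1 \<le> a" "a \<le> 2 * n" using assms by (auto simp: a_def Suc_le_eq)
    show "u \<in> strip_point n ` triples n"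
    proof (cases "y \<le> 2 * n * i + 2 * n")
      case True
      then have "(a, y - 2 * n * i, 2 * i + 1) \<in> triples n"
        using u a x by (auto simp: triples_def tri_index_def)
      moreover have "u = strip_point n (a, y - 2 * n * i, 2 * i + 1)"
        unfolding strip_point_odd using u x by auto
      ultimately show ?thesis by blast
    next
      case False
      then have "(y - 2 * n * i - 2 * n, a, 2 * i + 2) \<in> triples n"
        using u a x by (auto simp: triples_def tri_index_def)
      moreover have "u = strip_point n (y - 2 * n * i - 2 * n, a, 2 * i + 2)"
        unfolding strip_point_even using u x False by auto
      ultimately show ?thesis by blast
    qed
  qed
qed

lemma value_of_tri:
  assumes "(a, b, j) \<in> triples n"
  shows "value_of (tri n a b j) = hook (strip_point n (a, b, j))"
proof -
  have "1 \<le> j" "tri_index n a b" using assms by (auto simp: triples_def)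
  then show ?thesis
  proof (cases rule: odd_even_index_cases)
    case (1 i)
    have eq: "2 * n * (2 * i + 1 - 1) = 2 * n * i + 2 * n * i" by (simp add: algebra_simps)
    show ?thesis using \<open>tri_index n a b\<close>
      unfolding 1 strip_point_odd value_of_def tri_def hook_def fst_conv snd_conv eq tri_index_def
      by linarith
  next
    case (2 i)
    have eq: "2 * n * (2 * i + 2 - 1) = 2 * n * i + 2 * n * i + 2 * n" by (simp add: algebra_simps)
    show ?thesis using \<open>tri_index n a b\<close>
      unfolding 2 strip_point_even value_of_def tri_def hook_def fst_conv snd_conv eq tri_index_def
      by linarith
  qed
qed

text \<open>Points of triangles at distance two or more are always comparable, so the two difference conditions,
  for neighbouring triangles and for one triangle, exhaust all incomparable pairs.\<close>

lemma difference_conditions_iff: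
  assumes "1 \<le> n" "set_mset p \<subseteq> colored_ints n"
  shows "difference_conditions n p \<longleftrightarrow> (\<forall>x. count p x \<le> 1) \<and>
     (\<forall>a b j a' b' j'. (a, b, j) \<in> triples n \<longrightarrow> (a', b', j') \<in> triples n \<longrightarrow>
        tri n a b j \<in># p \<longrightarrow> tri n a' b' j' \<in># p \<longrightarrow> (a, b, j) \<noteq> (a', b', j') \<longrightarrow>
        comparable (strip_point n (a, b, j)) (strip_point n (a', b', j')))"
    (is "?L \<longleftrightarrow> ?count \<and> ?R")
proof -
  have count: "?count \<longleftrightarrow> (\<forall>x\<in>colored_ints n. count p x \<le> 1)"
    using assms(2) by (metis count_inI le0 subsetD)
  have sum: "count p x + count p y \<le> 1 \<longleftrightarrow> \<not> (x \<in># p \<and> y \<in># p)" if "?count" for x y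
  proof -
    have "count p x = 0 \<or> count p x = 1" "count p y = 0 \<or> count p y = 1"
      using that by (metis One_nat_def le_Suc_eq le_zero_eq)+
    then show ?thesis by (auto simp flip: count_greater_zero_iff)
  qed
  have inj: "tri n a b j \<noteq> tri n a' b' j'"
    if "(a, b, j) \<in> triples n" "(a', b', j') \<in> triples n" "(a, b, j) \<noteq> (a', b', j')" for a b j a' b' j'
    using bij_betw_imp_inj_on [OF bij_betw_tri [OF assms(1)]] that
    unfolding triples_def inj_on_def by fastforce
  show ?thesis
  proof
    assume L: ?L
    then have c: ?count unfolding count difference_conditions_def by (rule conjunct1)
    have *: "comparable (strip_point n (a, b, j)) (strip_point n (a', b', j'))"
      if t: "(a, b, j) \<in> triples n" "(a', b', j') \<in> triples n" "(a, b, j) \<noteq> (a', b', j')"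
        and p: "tri n a b j \<in># p" "tri n a' b' j' \<in># p" and "j \<le> j'" for a b j a' b' j'
    proof -
      have idx: "tri_index n a b" "tri_index n a' b'" "1 \<le> j" using t by (auto simp: triples_def)
      have ne: "tri n a b j \<noteq> tri n a' b' j'" "tri n a' b' j' \<noteq> tri n a b j"
        using inj [OF t] by auto
      consider "j' = j" | "j' = j + 1" | "j + 2 \<le> j'" using \<open>j \<le> j'\<close> by linarith
      then show ?thesis
      proof cases
        case 1
        have "\<not> (b \<le> b' \<and> a \<ge> a')" "\<not> (b' \<le> b \<and> a' \<ge> a)"
          using L p ne idx sum [OF c] unfolding 1 difference_conditions_def by blast+
        then show ?thesis unfolding 1 comparable_same_triangle [OF idx(3)] by linarith
      next
        case 2
        have "\<not> b' \<le> a"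
          using L p ne idx sum [OF c] unfolding 2 difference_conditions_def by blast
        then show ?thesis
          unfolding 2 using comparable_next_triangle [OF idx(3,2,1)] comparable_commute by auto
      next
        case 3
        then show ?thesis using comparable_far_triangle idx by blast
      qed
    qed
    have "?R"
    proof (intro allI impI)
      fix a b j a' b' j'
      assume t: "(a, b, j) \<in> triples n" "(a', b', j') \<in> triples n"
        and p: "tri n a b j \<in># p" "tri n a' b' j' \<in># p" and ne: "(a, b, j) \<noteq> (a', b', j')"
      consider "j \<le> j'" | "j' \<le> j" by linarith
      then show "comparable (strip_point n (a, b, j)) (strip_point n (a', b', j'))"
      proof cases
        case 1
        then show ?thesis using * [OF t ne p] by blast
      next
        case 2
        then show ?thesis using * [OF t(2,1) ne [symmetric] p(2,1)] comparable_commute by blast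
      qed
    qed
    then show "?count \<and> ?R" using c by blast
  next
    assume R: "?count \<and> ?R"
    have *: "comparable (strip_point n (a, b, j)) (strip_point n (a', b', j'))"
      if "tri_index n a b" "1 \<le> j" "tri_index n a' b'" "1 \<le> j'"
        "tri n a b j \<noteq> tri n a' b' j'" "tri n a b j \<in># p" "tri n a' b' j' \<in># p" for a b j a' b' j'
      using R that unfolding triples_def by blast
    show ?L
      unfolding difference_conditions_def sum [OF conjunct1 [OF R]]
    proof (intro conjI allI impI notI)
      show "\<forall>x\<in>colored_ints n. count p x \<le> 1" using R by blast
    next
      fix a b a' b' j
      assume h: "tri_index n a b \<and> tri_index n a' b' \<and> 1 \<le> j \<and> tri n a b (j + 1) \<noteq> tri n a' b' j \<and> b \<le> a'"
        "tri n a b (j + 1) \<in># p \<and> tri n a' b' j \<in># p"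
      then have "comparable (strip_point n (a, b, j + 1)) (strip_point n (a', b', j))"
        by (intro *) auto
      then show False using h comparable_next_triangle [of j n a b a' b'] by simp
    next
      fix a b a' b' j
      assume h: "tri_index n a b \<and> tri_index n a' b' \<and> 1 \<le> j \<and> tri n a b j \<noteq> tri n a' b' j \<and> b \<le> b' \<and> a' \<le> a"
        "tri n a b j \<in># p \<and> tri n a' b' j \<in># p"
      then have "comparable (strip_point n (a, b, j)) (strip_point n (a', b', j))"
        by (intro *) auto
      then show False using h comparable_same_triangle [of j n a b a' b'] by auto
    qed
  qed
qed

definition strip_color :: "nat \<Rightarrow> nat \<times> nat \<Rightarrow> colored_int" where
  "strip_color n u = (case inv_into (triples n) (strip_point n) u of (a, b, j) \<Rightarrow> tri n a b j)"

lemma strip_color_strip_point: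
  assumes "1 \<le> n" "(a, b, j) \<in> triples n"
  shows "strip_color n (strip_point n (a, b, j)) = tri n a b j"
  using bij_betw_inv_into_left [OF bij_betw_strip_point [OF assms(1)] assms(2)]
  by (simp add: strip_color_def)

lemma strip_cases:
  assumes "1 \<le> n" "u \<in> strip n"
  obtains a b j where "(a, b, j) \<in> triples n" "u = strip_point n (a, b, j)" "strip_color n u = tri n a b j"
proof -
  obtain t where "t \<in> triples n" "u = strip_point n t"
    using bij_betw_imp_surj_on [OF bij_betw_strip_point [OF assms(1)]] assms(2) by blast
  then show ?thesis using that strip_color_strip_point [OF assms(1)] by (cases t) auto
qed

lemma bij_betw_strip_color:
  assumes "1 \<le> n"
  shows "bij_betw (strip_color n) (strip n) (colored_ints n)"
proof -
  have "bij_betw ((\<lambda>(a, b, j). tri n a b j) \<circ> inv_into (triples n) (strip_point n)) (strip n) (colored_ints n)"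
    using bij_betw_tri [OF assms] bij_betw_inv_into [OF bij_betw_strip_point [OF assms]]
    unfolding triples_def [symmetric] by (rule bij_betw_trans [rotated])
  then show ?thesis by (simp add: comp_def strip_color_def cong: bij_betw_cong)
qed

lemma value_of_strip_color:
  assumes "1 \<le> n" "u \<in> strip n"
  shows "value_of (strip_color n u) = hook u"
  by (rule strip_cases [OF assms]) (simp add: value_of_tri)

lemma difference_conditions_strip:
  assumes "1 \<le> n" "set_mset p \<subseteq> colored_ints n"
  shows "difference_conditions n p \<longleftrightarrow> (\<forall>x. count p x \<le> 1) \<and>
     pairwise comparable {u \<in> strip n. strip_color n u \<in># p}"
proof -
  let ?C = "{u \<in> strip n. strip_color n u \<in># p}"
  let ?R = "\<forall>a b j a' b' j'. (a, b, j) \<in> triples n \<longrightarrow> (a', b', j') \<in> triples n \<longrightarrow>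
      tri n a b j \<in># p \<longrightarrow> tri n a' b' j' \<in># p \<longrightarrow> (a, b, j) \<noteq> (a', b', j') \<longrightarrow>
      comparable (strip_point n (a, b, j)) (strip_point n (a', b', j'))"
  have "pairwise comparable ?C" if R: ?R
  proof (rule pairwiseI)
    fix u v assume u: "u \<in> ?C" and v: "v \<in> ?C" and "u \<noteq> v"
    from u have "u \<in> strip n" by simp
    then obtain a b j where t: "(a, b, j) \<in> triples n" "u = strip_point n (a, b, j)"
      "strip_color n u = tri n a b j" by (rule strip_cases [OF assms(1)])
    from v have "v \<in> strip n" by simp
    then obtain a' b' j' where t': "(a', b', j') \<in> triples n" "v = strip_point n (a', b', j')"
      "strip_color n v = tri n a' b' j'" by (rule strip_cases [OF assms(1)])
    have "(a, b, j) \<noteq> (a', b', j')" using \<open>u \<noteq> v\<close> t t' by metis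
    moreover have "tri n a b j \<in># p" "tri n a' b' j' \<in># p" using u v t t' by simp_all
    ultimately show "comparable u v" using R t(1) t'(1) unfolding t(2) t'(2) by blast
  qed
  moreover have ?R if C: "pairwise comparable ?C"
  proof (intro allI impI)
    fix a b j a' b' j'
    assume t: "(a, b, j) \<in> triples n" "(a', b', j') \<in> triples n"
      and p: "tri n a b j \<in># p" "tri n a' b' j' \<in># p" and ne: "(a, b, j) \<noteq> (a', b', j')"
    have "strip_point n (a, b, j) \<noteq> strip_point n (a', b', j')"
      using bij_betw_imp_inj_on [OF bij_betw_strip_point [OF assms(1)]] t ne
      by (meson inj_onD)
    moreover have "strip_point n (a, b, j) \<in> ?C" "strip_point n (a', b', j') \<in> ?C"
      using t p bij_betw_apply [OF bij_betw_strip_point [OF assms(1)]]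
      by (simp_all add: strip_color_strip_point [OF assms(1)])
    ultimately show "comparable (strip_point n (a, b, j)) (strip_point n (a', b', j'))"
      using C unfolding pairwise_def by blast
  qed
  ultimately show ?thesis unfolding difference_conditions_iff [OF assms] by blast
qed

lemma card_colored_partitions:
  assumes "1 \<le> n"
  shows "card (chains_of n N) = card {p \<in> colored_partitions n N. difference_conditions n p}"
proof (rule bij_betw_same_card)
  let ?col = "strip_color n"
  let ?to = "\<lambda>C. mset_set (?col ` C)" and ?from = "\<lambda>p. {u \<in> strip n. ?col u \<in># p}"
  let ?D = "{p \<in> colored_partitions n N. difference_conditions n p}"
  have inj: "inj_on ?col (strip n)" and im: "?col ` strip n = colored_ints n"
    using bij_betw_strip_color [OF assms] by (auto simp: bij_betw_def)
  have from_to: "?from (?to C) = C" if "C \<in> chains_of n N" for C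
    using that inj by (auto simp: chains_of_def inj_on_def)
  have weight: "(\<Sum>x\<in>#?to C. value_of x) = (\<Sum>u\<in>C. hook u)" if "C \<subseteq> strip n" "finite C" for C
  proof -
    have "(\<Sum>x\<in>#?to C. value_of x) = (\<Sum>x\<in>?col ` C. value_of x)"
      by (simp add: sum_unfold_sum_mset)
    also have "\<dots> = (\<Sum>u\<in>C. value_of (?col u))"
      using inj_on_subset [OF inj that(1)] by (simp add: sum.reindex)
    also have "\<dots> = (\<Sum>u\<in>C. hook u)"
      using that by (intro sum.cong refl value_of_strip_color assms) auto
    finally show ?thesis .
  qed
  have to_from: "?to (?from p) = p" if p: "p \<in> ?D" for p
  proof -
    have sub: "set_mset p \<subseteq> colored_ints n" using p by (auto simp: colored_partitions_def)
    have c: "count p x \<le> 1" for x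
      using p difference_conditions_strip [OF assms sub] by blast
    have "?col ` ?from p = set_mset p" using sub unfolding im [symmetric] by blast
    moreover have "mset_set (set_mset p) = p"
    proof (rule multiset_eqI)
      fix x
      have "count p x = 1" if "x \<in># p"
        using that c [of x] by (metis count_eq_zero_iff le_less less_one)
      then show "count (mset_set (set_mset p)) x = count p x"
        by (simp add: count_mset_set' not_in_iff)
    qed
    ultimately show ?thesis by simp
  qed
  show "bij_betw ?to (chains_of n N) ?D"
  proof (rule bij_betw_byWitness [where f' = ?from])
    show "?to ` chains_of n N \<subseteq> ?D"
    proof (rule image_subsetI)
      fix C assume C: "C \<in> chains_of n N"
      have sub: "set_mset (?to C) \<subseteq> colored_ints n" using C im by (auto simp: chains_of_def)
      moreover have "difference_conditions n (?to C)"
        unfolding difference_conditions_strip [OF assms sub] from_to [OF C]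
        using C by (auto simp: chains_of_def count_mset_set')
      ultimately show "?to C \<in> ?D"
        using C weight [of C] by (auto simp: chains_of_def colored_partitions_def)
    qed
    show "?from ` ?D \<subseteq> chains_of n N"
    proof (rule image_subsetI)
      fix p assume p: "p \<in> ?D"
      have sub: "set_mset p \<subseteq> colored_ints n" using p by (auto simp: colored_partitions_def)
      have "finite (?col ` ?from p)" by (rule finite_subset [of _ "set_mset p"]) auto
      then have fin: "finite (?from p)" by (rule finite_imageD) (rule inj_on_subset [OF inj], auto)
      have "(\<Sum>u\<in>?from p. hook u) = N"
        using weight [of "?from p"] fin to_from [OF p] p by (auto simp: colored_partitions_def)
      then show "?from p \<in> chains_of n N"
        using fin p difference_conditions_strip [OF assms sub] by (auto simp: chains_of_def)
    qed
  qed (use from_to to_from in auto)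
qed

theorem theorem12p1:
  fixes n N :: nat
  assumes "n \<ge> 2" and "N \<ge> 1"
  shows "card (congruence_partitions n N) =
         card {p \<in> colored_partitions n N. difference_conditions n p}"
proof -
  have "1 \<le> n" using assms by simp
  then show ?thesis by (simp only: card_chains_of [symmetric] card_colored_partitions)
qed

end
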